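(* Let $A$ be a fixed subset of $\mathbb C^+$ that contains an accumulation point in $\mathbb C^+$. For each $n\in\mathbb N$, let $(\mathfrak b^n_{s,t})_{s\le t}$ be the $\uplus$-convolution hemigroup having generator $(\gamma^n_t,\eta^n_t)_{t\in I}$. Similarly, let $(\mathfrak b_{s,t})_{s\le t}$ be the $\uplus$-convolution hemigroup with generator $(\gamma_t,\eta_t)_{t\in I}$. Then the following conditions are equivalent (as $n\to\infty$): (1) $(\mathfrak b^n_{s,t})$ converges weakly to $(\mathfrak b_{s,t})$ locally uniformly on $I^2_\le$; (2) $K[\mathfrak b^n_{0,t}](z)$ converges to $K[\mathfrak b_{0,t}](z)$ locally uniformly on $\mathbb C^+\times I$; (3) $K[\mathfrak b^n_{0,t}](z)$ converges to $K[\mathfrak b_{0,t}](z)$ locally uniformly in $t\in I$ for each $z\in A$; (4) $(\gamma^n_t)_t$ converges to $(\gamma_t)_t$ locally uniformly on $I$, and the following mutually equivalent conditions are fulfilled: (i) $(\eta^n_t)_t$ converges weakly to $(\eta_t)_t$ locally uniformly on $I$; (ii) $\eta^n_t$ converges weakly to $\eta_t$ for each $t\in I$; (iii) $\mathcal H^n|_{\mathbb R\times[0,T]}$ converges weakly to $\mathcal H|_{\mathbb R\times[0,T]}$ for each $T\in I$.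
   Context: $I$ is a fixed interval $[0,T_0)$ ($0<T_0\le+\infty$) or $[0,T_0]$ ($0<T_0<+\infty$), and $I^2_\le=\{(s,t)\in I^2:s\le t\}$. $\mathbb C^+$ is the open upper half-plane; $\mathbf P(\mathbb R)$, $\mathbf M(\mathbb R)$ are the sets of Borel probability measures and of finite nonnegative Borel measures on $\mathbb R$. For $\mu\in\mathbf P(\mathbb R)$: $G_\mu(z)=\int\frac1{z-x}\mu(dx)$, $F_\mu=1/G_\mu$, and the energy function $K_\mu=K[\mu]$ is $K_\mu(z)=z-F_\mu(z)$, $z\in\mathbb C^+$. Boolean convolution $\uplus$ on $\mathbf P(\mathbb R)$ is determined by $K_{\mu\uplus\nu}=K_\mu+K_\nu$. A $\uplus$-convolution hemigroup is a family $(\mu_{s,t})_{(s,t)\in I^2_\le}$ in $\mathbf P(\mathbb R)$ with $\mu_{s,s}=\delta_0$, $\mu_{s,t}\uplus\mu_{t,u}=\mu_{s,u}$ for $s\le t\le u$, and $(s,t)\mapsto\mu_{s,t}$ weakly continuous. Here generators are families $(\gamma_t,\eta_t)_{t\in I}$ in $\mathbb R\times\mathbf M(\mathbb R)$ such that $\gamma_0=0$, $t\mapsto\gamma_t$ is continuous, $\eta_0=0$, and $t\mapsto\eta_t(B)$ is nondecreasing and continuous for every Borel $B\subset\mathbb R$. The $\uplus$-convolution hemigroup with generator $(\gamma_t,\eta_t)_t$ is the unique one with $K[\mathfrak b_{0,t}](z)=\gamma_t+\int_{\mathbb R}\frac{1+xz}{z-x}\,\eta_t(dx)$ for all $t\in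 I$, $z\in\mathbb C^+$; every $\uplus$-convolution hemigroup has a unique generator. $\mathcal H$ is the Borel measure on $\mathbb R\times I$ with $\mathcal H(B\times(s,t])=\eta_t(B)-\eta_s(B)$ and $\mathcal H(\mathbb R\times\{0\})=0$; $\mathcal H^n$ is defined likewise from $\eta^n$; $\mathcal H|_{\mathbb R\times[0,T]}$ is the restriction to Borel subsets of $\mathbb R\times[0,T]$. For $\mathbb I=I$ or $I^2_\le$, $(\mu^n_\tau)_{\tau\in\mathbb I}$ converges weakly to $(\mu_\tau)_{\tau\in\mathbb I}$ locally uniformly on $\mathbb I$ if $\lim_n\sup_{\tau\in K}|\int f\,d\mu^n_\tau-\int f\,d\mu_\tau|=0$ for every compact $K\subset\mathbb I$ and every bounded continuous $f:\mathbb R\to\mathbb R$. *)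

theory Defs
  imports "HOL-Probability.Probability"
begin

text \<open>The admissible time sets are \<open>[0,T)\<close> with \<open>0 < T \<le> \<infinity>\<close> and
  \<open>[0,T]\<close> with \<open>0 < T < \<infinity>\<close>; the case \<open>T = \<infinity>\<close> is \<open>{0..}\<close>.\<close>

definition time_interval :: "real set \<Rightarrow> bool" where
  "time_interval I \<longleftrightarrow> I = {0..} \<or> (\<exists>T>0. I = {0..<T}) \<or> (\<exists>T>0. I = {0..T})"

definition ordered_pairs :: "real set \<Rightarrow> (real \<times> real) set" where
  "ordered_pairs I = {(s, t). s \<in> I \<and> t \<in> I \<and> s \<le> t}"

definition upper_half_plane :: "complex set" where
  "upper_half_plane = {z. Im z > 0}"


subsection \<open>Boolean convolution\<close>

definition cauchy_transform :: "real measure \<Rightarrow> complex \<Rightarrow> complex" where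
  "cauchy_transform \<mu> z = (LINT x|\<mu>. 1 / (z - of_real x))"

definition reciprocal_cauchy_transform :: "real measure \<Rightarrow> complex \<Rightarrow> complex" where
  "reciprocal_cauchy_transform \<mu> z = 1 / cauchy_transform \<mu> z"

definition energy :: "real measure \<Rightarrow> complex \<Rightarrow> complex" where
  "energy \<mu> z = z - reciprocal_cauchy_transform \<mu> z"

text \<open>The graph of the operation: \<open>is_boolean_convolution \<mu> \<nu> \<rho>\<close> says that the probability measure
  \<open>\<rho>\<close> is the Boolean convolution of \<open>\<mu>\<close> and \<open>\<nu>\<close>.  The energy function determines a
  probability measure uniquely, so there is exactly one such \<open>\<rho>\<close>.\<close>

definition is_boolean_convolution :: "real measure \<Rightarrow> real measure \<Rightarrow> real measure \<Rightarrow> bool" where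
  "is_boolean_convolution \<mu> \<nu> \<rho> \<longleftrightarrow>
     real_distribution \<mu> \<and> real_distribution \<nu> \<and> real_distribution \<rho> \<and>
     (\<forall>z\<in>upper_half_plane. energy \<rho> z = energy \<mu> z + energy \<nu> z)"


subsection \<open>Convergence\<close>

text \<open>Locally uniform convergence is uniform convergence on compact subsets.\<close>

definition locally_uniform_limit ::
    "'a::topological_space set \<Rightarrow> (nat \<Rightarrow> 'a \<Rightarrow> 'b::metric_space) \<Rightarrow> ('a \<Rightarrow> 'b) \<Rightarrow> bool" where
  "locally_uniform_limit S f g \<longleftrightarrow>
     (\<forall>K. compact K \<and> K \<subseteq> S \<longrightarrow> uniform_limit K f g sequentially)"

text \<open>The library's \<open>weak_conv_m\<close> is defined through distribution functions of real probability
  measures.  Here one needs finite measures, also on \<open>\<real> \<times> [0,T]\<close>, and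
  convergence locally uniform in a parameter, hence the definitions by bounded continuous test
  functions.  The set \<open>S\<close> is the topological space carrying the measures.\<close>

definition weakly_converges_on ::
    "'a::topological_space set \<Rightarrow> (nat \<Rightarrow> 'a measure) \<Rightarrow> 'a measure \<Rightarrow> bool" where
  "weakly_converges_on S M N \<longleftrightarrow>
     (\<forall>f :: 'a \<Rightarrow> real. continuous_on S f \<and> bounded (f ` S) \<longrightarrow>
        (\<lambda>n. LINT x|M n. f x) \<longlonglongrightarrow> (LINT x|N. f x))"

definition weakly_converges_locally_uniformly ::
    "'i::topological_space set \<Rightarrow> (nat \<Rightarrow> 'i \<Rightarrow> real measure) \<Rightarrow> ('i \<Rightarrow> real measure) \<Rightarrow> bool" where
  "weakly_converges_locally_uniformly S M N \<longleftrightarrow>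
     (\<forall>f :: real \<Rightarrow> real. continuous_on UNIV f \<and> bounded (range f) \<longrightarrow>
        locally_uniform_limit S (\<lambda>n \<tau>. LINT x|M n \<tau>. f x) (\<lambda>\<tau>. LINT x|N \<tau>. f x))"

definition weakly_continuous_on :: "'i::topological_space set \<Rightarrow> ('i \<Rightarrow> real measure) \<Rightarrow> bool" where
  "weakly_continuous_on S M \<longleftrightarrow>
     (\<forall>f :: real \<Rightarrow> real. continuous_on UNIV f \<and> bounded (range f) \<longrightarrow>
        continuous_on S (\<lambda>\<tau>. LINT x|M \<tau>. f x))"


subsection \<open>Hemigroups and generators\<close>

definition boolean_hemigroup :: "real set \<Rightarrow> (real \<times> real \<Rightarrow> real measure) \<Rightarrow> bool" where
  "boolean_hemigroup I \<mu> \<longleftrightarrow>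
     (\<forall>(s, t)\<in>ordered_pairs I. real_distribution (\<mu> (s, t))) \<and>
     (\<forall>s\<in>I. \<mu> (s, s) = return borel 0) \<and>
     (\<forall>s\<in>I. \<forall>t\<in>I. \<forall>u\<in>I. s \<le> t \<and> t \<le> u \<longrightarrow>
        is_boolean_convolution (\<mu> (s, t)) (\<mu> (t, u)) (\<mu> (s, u))) \<and>
     weakly_continuous_on (ordered_pairs I) \<mu>"

definition generating_family :: "real set \<Rightarrow> (real \<Rightarrow> real) \<Rightarrow> (real \<Rightarrow> real measure) \<Rightarrow> bool" where
  "generating_family I \<gamma> \<eta> \<longleftrightarrow>
     \<gamma> 0 = 0 \<and> continuous_on I \<gamma> \<and>
     (\<forall>t\<in>I. finite_borel_measure (\<eta> t)) \<and> \<eta> 0 = null_measure borel \<and>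
     (\<forall>B\<in>sets borel. mono_on I (\<lambda>t. measure (\<eta> t) B) \<and>
                      continuous_on I (\<lambda>t. measure (\<eta> t) B))"

definition boolean_hemigroup_with_generator ::
    "real set \<Rightarrow> (real \<times> real \<Rightarrow> real measure) \<Rightarrow> (real \<Rightarrow> real) \<Rightarrow> (real \<Rightarrow> real measure) \<Rightarrow> bool" where
  "boolean_hemigroup_with_generator I \<mu> \<gamma> \<eta> \<longleftrightarrow>
     boolean_hemigroup I \<mu> \<and> generating_family I \<gamma> \<eta> \<and>
     (\<forall>t\<in>I. \<forall>z\<in>upper_half_plane.
        energy (\<mu> (0, t)) z =
          of_real (\<gamma> t) + (LINT x|\<eta> t. (1 + of_real x * z) / (z - of_real x)))"

text \<open>\<open>is_space_time_measure I \<eta> H\<close> characterises the Borel measure \<open>H\<close> on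
  \<open>\<real> \<times> I\<close> with \<open>H (B \<times> (s,t]) = \<eta>\<^sub>t(B) - \<eta>\<^sub>s(B)\<close>; for a generating family exactly one such
  measure exists.  The truncated subtraction on \<^typ>\<open>ennreal\<close> is harmless, since
  \<open>\<eta>\<^sub>s(B) \<le> \<eta>\<^sub>t(B) < \<infinity>\<close>.\<close>

definition is_space_time_measure ::
    "real set \<Rightarrow> (real \<Rightarrow> real measure) \<Rightarrow> (real \<times> real) measure \<Rightarrow> bool" where
  "is_space_time_measure I \<eta> H \<longleftrightarrow>
     sets H = sets (restrict_space borel (UNIV \<times> I)) \<and>
     (\<forall>B\<in>sets borel. \<forall>s\<in>I. \<forall>t\<in>I. s \<le> t \<longrightarrow>
        emeasure H (B \<times> {s<..t}) = emeasure (\<eta> t) B - emeasure (\<eta> s) B) \<and>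
     emeasure H (UNIV \<times> {0}) = 0"

end

theory Submission
  imports Defs "HOL-Complex_Analysis.Conformal_Mappings"
begin

text \<open>
  All conditions speak about the functions
  \<open>energy (\<bb> (0, t)) z = \<gamma>\<^sub>t + \<integral> (1 + xz) / (z - x) \<eta>\<^sub>t(dx)\<close>, and the theorem rests on
  two ideas.

  The first one removes the parameter. All limits in question are continuous, so locally uniform
  convergence is the same as convergence along every convergent sequence of parameters
  (\<open>locally_uniform_limit_imp_sequences\<close>, \<open>sequences_imp_locally_uniform_limit\<close>). Every condition
  thus becomes a statement on one sequence of measures at a time.

  The second one is a continuity theorem for a single sequence, \<open>nevanlinna_continuity\<close>: if
  \<open>\<gamma>\<^sub>n + \<integral> (1 + xz) / (z - x) \<sigma>\<^sub>n(dx)\<close> converges to a function of the same form on a set with an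
  accumulation point, then the constants converge and the measures converge weakly. In the variable
  \<open>\<zeta> = (z - \<i>) / (z + \<i>)\<close> of the unit disc these functions are power series whose coefficients
  are the moments \<open>\<integral> u\<^sup>k d\<sigma>\<^sub>n\<close> of the image of \<open>\<sigma>\<^sub>n\<close> on the unit circle. Convergence at one
  point bounds the total masses, hence the coefficients, and a compactness argument together with
  the identity theorem makes the coefficients converge. The Stone-Weierstrass theorem on the circle
  turns this into convergence of integrals of continuous functions on the circle. No mass escapes
  to infinity, which is the point \<open>1\<close> of the circle, because the limiting moments are those of a
  measure on the line and include its total mass.

  Convergence of \<open>\<gamma>\<close> and \<open>\<eta>\<close> gives convergence of the energies because the kernel is
  continuous and bounded in \<open>x\<close>. The laws \<open>\<bb> (s, t)\<close> are reached through
  \<open>energy (\<bb> (s, t)) = energy (\<bb> (0, t)) - energy (\<bb> (0, s))\<close>. For a probability measure the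
  energy is an invertible function of the Cauchy transform \<open>G\<close>, and \<open>(1 + z\<^sup>2) G(z) - z\<close> is again an
  integral of the kernel above, so that the same continuity theorem applies.

  The three forms of convergence of \<open>\<eta>\<close> agree for reasons of monotonicity. Integrals of nonnegative
  functions are nondecreasing in \<open>t\<close>, and monotone functions that converge pointwise to a
  continuous one do so locally uniformly (\<open>monotone_pointwise_imp_locally_uniform\<close>). The integral of
  a continuous function against the space-time measure is a uniform limit of Riemann-Stieltjes sums,
  which involve \<open>\<eta>\<close> at finitely many times only (\<open>step_integral_close\<close>).
\<close>

section \<open>Locally uniform convergence along convergent sequences\<close>

text \<open>A convergent sequence together with its limit is a compact set, on which the convergence is
  uniform.\<close>

lemma locally_uniform_limit_imp_sequences:
  fixes g :: "'a::heine_borel \<Rightarrow> 'b::metric_space"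
  assumes lim: "locally_uniform_limit S f g" and g: "continuous_on S g"
    and r: "filterlim r at_top sequentially"
    and x: "\<And>k. x k \<in> S" "x \<longlonglongrightarrow> l" and l: "l \<in> S"
  shows "(\<lambda>k. f (r k) (x k)) \<longlonglongrightarrow> g l"
proof -
  define K where "K = insert l (range x)"
  have "compact K"
    unfolding K_def by (rule compact_sequence_with_limit) (rule x)
  moreover have "K \<subseteq> S"
    using x l by (auto simp: K_def)
  ultimately have "uniform_limit K f g sequentially"
    using lim by (auto simp: locally_uniform_limit_def)
  then have "uniform_limit K (\<lambda>k. f (r k)) g sequentially"
    using r by (rule filterlim_compose)
  moreover have "(\<lambda>k. g (x k)) \<longlonglongrightarrow> g l"
    by (rule continuous_on_tendsto_compose[OF g x(2) l]) (simp add: x)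
  moreover have "(\<lambda>k. dist (f (r k) (x k)) (g (x k))) \<longlonglongrightarrow> 0"
  proof (rule tendstoI)
    fix e :: real assume "e > 0"
    from uniform_limitD[OF \<open>uniform_limit K (\<lambda>k. f (r k)) g sequentially\<close> this]
    show "\<forall>\<^sub>F k in sequentially. dist (dist (f (r k) (x k)) (g (x k))) 0 < e"
      by eventually_elim (simp add: K_def)
  qed
  ultimately have "(\<lambda>k. dist (f (r k) (x k)) (g (x k)) + dist (g (x k)) (g l)) \<longlonglongrightarrow> 0 + 0"
    by (intro tendsto_add) (simp_all add: tendsto_dist_iff[symmetric])
  then have "(\<lambda>k. dist (f (r k) (x k)) (g l)) \<longlonglongrightarrow> 0"
    by (intro tendsto_0_le[where K = 1 and g = "\<lambda>k. dist (f (r k) (x k)) (g l)"])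
      (auto intro!: always_eventually dist_triangle)
  then show ?thesis
    by (simp add: tendsto_dist_iff[symmetric])
qed

text \<open>If the convergence fails to be uniform on a compact set, there are indices and points of the set
  at which the error stays large; a convergent subsequence of these points contradicts the hypothesis.\<close>

lemma sequences_imp_locally_uniform_limit:
  fixes g :: "'a::metric_space \<Rightarrow> 'b::metric_space"
  assumes g: "continuous_on S g"
    and *: "\<And>r x l. strict_mono r \<Longrightarrow> (\<And>k. x k \<in> S) \<Longrightarrow> x \<longlonglongrightarrow> l \<Longrightarrow> l \<in> S \<Longrightarrow>
              (\<lambda>k. f (r k) (x k)) \<longlonglongrightarrow> g l"
  shows "locally_uniform_limit S f g"
  unfolding locally_uniform_limit_def
proof (intro allI impI, elim conjE)
  fix K assume K: "compact K" "K \<subseteq> S"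
  show "uniform_limit K f g sequentially"
  proof (rule ccontr)
    assume "\<not> uniform_limit K f g sequentially"
    then obtain e where e: "e > 0" and ne: "\<not> (\<forall>\<^sub>F n in sequentially. \<forall>x\<in>K. dist (f n x) (g x) < e)"
      by (auto simp: uniform_limit_iff)
    obtain q :: "nat \<Rightarrow> nat" where q: "strict_mono q" "\<And>k. \<not> (\<forall>x\<in>K. dist (f (q k) x) (g x) < e)"
      using not_eventually_sequentiallyD[OF ne] by blast
    then obtain x where x: "\<And>k. x k \<in> K" "\<And>k. e \<le> dist (f (q k) (x k)) (g (x k))"
      by (metis not_le)
    obtain l p where l: "l \<in> K" and p: "strict_mono p" and xp: "(x \<circ> p) \<longlonglongrightarrow> l"
      using seq_compactE[OF compact_imp_seq_compact[OF K(1)], of x] x(1) by metis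
    have "(\<lambda>k. f ((q \<circ> p) k) ((x \<circ> p) k)) \<longlonglongrightarrow> g l"
      using x(1) l K(2) by (intro * strict_mono_o q(1) p xp) auto
    moreover have "(\<lambda>k. g ((x \<circ> p) k)) \<longlonglongrightarrow> g l"
      using x(1) l K(2) by (intro continuous_on_tendsto_compose[OF g xp]) (auto intro!: always_eventually)
    ultimately have "(\<lambda>k. dist (f ((q \<circ> p) k) ((x \<circ> p) k)) (g ((x \<circ> p) k))) \<longlonglongrightarrow> dist (g l) (g l)"
      by (rule tendsto_dist)
    moreover have "e \<le> dist (f ((q \<circ> p) k) ((x \<circ> p) k)) (g ((x \<circ> p) k))" for k
      using x(2) by simp
    ultimately have "e \<le> dist (g l) (g l)"
      by (meson LIMSEQ_le_const)
    then show False
      using e by simp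
  qed
qed

section \<open>Power series with converging values have converging coefficients\<close>

text \<open>Sequential compactness of a countable product of closed discs; it replaces the diagonal argument.\<close>

lemma bounded_coefficients_convergent_subsequence:
  fixes a :: "nat \<Rightarrow> nat \<Rightarrow> complex"
  assumes "\<And>n k. norm (a n k) \<le> M"
  obtains r l where "strict_mono (r :: nat \<Rightarrow> nat)" "\<And>k. (\<lambda>n. a (r n) k) \<longlonglongrightarrow> l k" "\<And>k. norm (l k) \<le> M"
proof -
  define B where "B = (\<Pi>\<^sub>E k\<in>(UNIV::nat set). cball (0::complex) M)"
  have "compactin (product_topology (\<lambda>_::nat. euclidean) UNIV) B"
    unfolding B_def by (subst compactin_PiE) auto
  then have "compact B"
    by (simp add: euclidean_product_topology)
  have "\<forall>n. a n \<in> B"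
    using assms by (auto simp: B_def)
  then obtain l r where l: "l \<in> B" and r: "strict_mono r" and lim: "(a \<circ> r) \<longlonglongrightarrow> l"
    using seq_compactE[OF compact_imp_seq_compact[OF \<open>compact B\<close>], of a] by metis
  have "(\<lambda>n. a (r n) k) \<longlonglongrightarrow> l k" for k
  proof -
    have "continuous_on UNIV (\<lambda>f::nat \<Rightarrow> complex. f k)"
      by (rule continuous_on_product_coordinates)
    from continuous_on_tendsto_compose[OF this lim] show ?thesis by simp
  qed
  with l r show ?thesis
    by (intro that) (auto simp: B_def)
qed

lemma tendsto_power_series:
  fixes a :: "nat \<Rightarrow> nat \<Rightarrow> complex"
  assumes "\<And>n k. norm (a n k) \<le> M" "\<And>k. (\<lambda>n. a n k) \<longlonglongrightarrow> l k" "norm z < 1"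
  shows "(\<lambda>n. \<Sum>k. a n k * z ^ k) \<longlonglongrightarrow> (\<Sum>k. l k * z ^ k)"
proof -
  have "M \<ge> 0"
    using norm_ge_zero order_trans assms(1) by blast
  have lim: "(\<lambda>n. a n k * z ^ k) \<longlonglongrightarrow> l k * z ^ k" for k
    by (intro tendsto_intros assms)
  have bound: "\<forall>\<^sub>F (k, n) in sequentially \<times>\<^sub>F sequentially. norm (a n k * z ^ k) \<le> M * norm z ^ k"
    using assms(1) by (intro always_eventually) (auto simp: norm_mult norm_power intro!: mult_right_mono)
  have "summable (\<lambda>k. M * norm z ^ k)"
    using assms(3) by (intro summable_mult summable_geometric) auto
  from tannerys_theorem[OF lim bound this] show ?thesis
    by simp
qed

text \<open>The bound on the coefficients makes both series holomorphic in the unit disc, so the identity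
  theorem applies to their difference.\<close>

lemma power_series_coefficients_unique:
  fixes a b :: "nat \<Rightarrow> complex"
  assumes a: "\<And>k. norm (a k) \<le> M" and b: "\<And>k. norm (b k) \<le> M"
    and A: "A \<subseteq> ball 0 1" "\<xi> \<in> ball 0 1" "\<xi> islimpt A"
    and eq: "\<And>z. z \<in> A \<Longrightarrow> (\<Sum>k. a k * z ^ k) = (\<Sum>k. b k * z ^ k)"
  shows "a = b"
proof -
  define c where "c k = a k - b k" for k
  have c: "norm (c k) \<le> 2 * M" for k
    using norm_triangle_ineq4[of "a k" "b k"] a[of k] b[of k] by (simp add: c_def)
  have summable: "summable (\<lambda>k. d k * z ^ k)" if "\<And>k. norm (d k) \<le> R" "norm z < 1"
    for d :: "nat \<Rightarrow> complex" and z R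
  proof (rule summable_comparison_test)
    show "\<exists>N. \<forall>n\<ge>N. norm (d n * z ^ n) \<le> R * norm z ^ n"
      using that by (auto simp: norm_mult norm_power intro!: mult_right_mono)
    show "summable (\<lambda>n. R * norm z ^ n)"
      using that by (intro summable_mult summable_geometric) auto
  qed
  define f where "f z = (\<Sum>k. c k * z ^ k)" for z
  have sums: "(\<lambda>k. c k * z ^ k) sums f z" if "norm z < 1" for z
    using summable[OF c that] by (simp add: f_def summable_sums)
  have hol: "f holomorphic_on ball 0 1"
    by (rule power_series_holomorphic[of 0 1 c]) (use sums in auto)
  have f0: "f z = 0" if "z \<in> A" for z
  proof -
    have "norm z < 1" using A(1) that by auto
    then show ?thesis
      using suminf_diff[OF summable[of a M z] summable[of b M z]] a b eq[OF that]
      by (simp add: f_def c_def left_diff_distrib)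
  qed
  have f_zero: "f z = 0" if "z \<in> ball 0 1" for z
    by (rule analytic_continuation[OF hol _ _ A f0 that]) auto
  have sums0: "(\<lambda>k. c k * z ^ k) sums 0" if "norm z < 1" for z
    using sums[OF that] f_zero[of z] that by simp
  have "c m = 0" for m
  proof (cases "m = 0")
    case True
    have "(\<lambda>k. c k * 0 ^ k) sums c 0"
      by (rule powser_sums_zero)
    with sums0[of 0] True show ?thesis
      using sums_unique2 by auto
  next
    case False
    show ?thesis
    proof (rule ccontr)
      assume m: "c m \<noteq> 0"
      obtain s where "0 < s" "\<And>z. z \<in> cball (0::complex) s - {0} \<Longrightarrow> (\<lambda>_. 0::complex) z \<noteq> 0"
        by (rule powser_0_nonzero[of 1 0 c "\<lambda>_. 0" m]) (use sums0 m False in auto)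
      from this(2)[of "of_real s"] \<open>0 < s\<close> show False
        by simp
    qed
  qed
  then show ?thesis
    by (auto simp: c_def)
qed

text \<open>A form of Vitali's theorem: by compactness every subsequence of the coefficient sequences has a
  further one that converges, and its limit is the coefficient sequence of a power series that agrees
  with the given limit on \<open>A\<close>.\<close>

lemma power_series_coefficients_tendsto:
  fixes a :: "nat \<Rightarrow> nat \<Rightarrow> complex"
  assumes a: "\<And>n k. norm (a n k) \<le> M" and b: "\<And>k. norm (b k) \<le> M"
    and A: "A \<subseteq> ball 0 1" "\<xi> \<in> ball 0 1" "\<xi> islimpt A"
    and lim: "\<And>z. z \<in> A \<Longrightarrow> (\<lambda>n. \<Sum>k. a n k * z ^ k) \<longlonglongrightarrow> (\<Sum>k. b k * z ^ k)"
  shows "(\<lambda>n. a n k) \<longlonglongrightarrow> b k"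
proof (rule ccontr)
  assume "\<not> (\<lambda>n. a n k) \<longlonglongrightarrow> b k"
  then obtain e where e: "e > 0" "\<not> (\<forall>\<^sub>F n in sequentially. dist (a n k) (b k) < e)"
    by (auto simp: tendsto_iff)
  obtain q :: "nat \<Rightarrow> nat" where q: "strict_mono q" "\<And>n. \<not> dist (a (q n) k) (b k) < e"
    using not_eventually_sequentiallyD[OF e(2)] by blast
  obtain r l where r: "strict_mono r" and l: "\<And>j. (\<lambda>n. a (q (r n)) j) \<longlonglongrightarrow> l j"
    and lM: "\<And>j. norm (l j) \<le> M"
    by (rule bounded_coefficients_convergent_subsequence[of "\<lambda>n. a (q n)" M]) (use a in blast)+
  have "l = b"
  proof (rule power_series_coefficients_unique[OF lM b A])
    fix z assume z: "z \<in> A"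
    have "(\<lambda>n. \<Sum>j. a (q (r n)) j * z ^ j) \<longlonglongrightarrow> (\<Sum>j. l j * z ^ j)"
      by (rule tendsto_power_series[OF a l]) (use z A(1) in auto)
    moreover have "(\<lambda>n. \<Sum>j. a (q (r n)) j * z ^ j) \<longlonglongrightarrow> (\<Sum>j. b j * z ^ j)"
      using LIMSEQ_subseq_LIMSEQ[OF lim[OF z] strict_mono_o[OF q(1) r]] by (simp add: o_def)
    ultimately show "(\<Sum>j. l j * z ^ j) = (\<Sum>j. b j * z ^ j)"
      by (rule LIMSEQ_unique)
  qed
  then have "\<forall>\<^sub>F n in sequentially. dist (a (q (r n)) k) (b k) < e"
    using l[of k] e(1) by (auto simp: tendsto_iff)
  then show False
    using q(2) by (auto simp: eventually_sequentially)
qed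

section \<open>Cauchy and Nevanlinna transforms of finite measures\<close>

lemma finite_borel_measure_space: "finite_borel_measure \<sigma> \<Longrightarrow> space \<sigma> = UNIV"
  using sets_eq_imp_space_eq[of \<sigma> borel] by (simp add: finite_borel_measure_def finite_borel_measure_axioms_def)

lemma (in finite_borel_measure) integrable_bounded_continuous:
  fixes f :: "real \<Rightarrow> 'b::{banach, second_countable_topology}"
  assumes "continuous_on UNIV f" "bounded (range f)"
  shows "integrable M f"
proof -
  obtain B where "\<And>x. norm (f x) \<le> B"
    using assms(2) by (auto simp: bounded_iff)
  moreover have "f \<in> borel_measurable M"
    using borel_measurable_continuous_onI[OF assms(1)] measurable_cong_sets[OF M_is_borel refl] by blast
  ultimately show ?thesis
    by (intro integrable_const_bound[where B = B]) auto
qed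

lemma (in finite_borel_measure) norm_integral_le:
  fixes f :: "real \<Rightarrow> complex"
  assumes "continuous_on UNIV f" "\<And>x. norm (f x) \<le> B"
  shows "norm (LINT x|M. f x) \<le> B * measure M UNIV"
proof -
  have int: "integrable M f"
    using assms by (intro integrable_bounded_continuous) (auto simp: bounded_iff)
  have "norm (LINT x|M. f x) \<le> (LINT x|M. norm (f x))"
    by simp
  also have "\<dots> \<le> (LINT x|M. B)"
    using assms int by (intro integral_mono) auto
  also have "\<dots> = B * measure M UNIV"
    using finite_borel_measure_space[OF finite_borel_measure_axioms] by simp
  finally show ?thesis .
qed

lemma weakly_converges_onD_complex:
  fixes f :: "real \<Rightarrow> complex"
  assumes \<sigma>: "\<And>n. finite_borel_measure (\<sigma> n)" "finite_borel_measure \<sigma>'"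
    and lim: "weakly_converges_on UNIV \<sigma> \<sigma>'"
    and f: "continuous_on UNIV f" "bounded (range f)"
  shows "(\<lambda>n. LINT x|\<sigma> n. f x) \<longlonglongrightarrow> (LINT x|\<sigma>'. f x)"
proof -
  have int: "integrable M f" if "finite_borel_measure M" for M
    using finite_borel_measure.integrable_bounded_continuous[OF that f] .
  have Re: "Re (LINT x|M. f x) = (LINT x|M. Re (f x))" and Im: "Im (LINT x|M. f x) = (LINT x|M. Im (f x))"
    if "finite_borel_measure M" for M
    using integral_bounded_linear[OF bounded_linear_Re int[OF that]]
      integral_bounded_linear[OF bounded_linear_Im int[OF that]] by simp_all
  obtain B where B: "\<And>x. norm (f x) \<le> B"
    using f(2) by (auto simp: bounded_iff)
  have "bounded (range (\<lambda>x. Re (f x)))" "bounded (range (\<lambda>x. Im (f x)))"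
    using B abs_Re_le_cmod abs_Im_le_cmod by (auto simp: bounded_iff intro!: exI[of _ B] intro: order_trans)
  moreover have "continuous_on UNIV (\<lambda>x. Re (f x))" "continuous_on UNIV (\<lambda>x. Im (f x))"
    using f(1) by (auto intro: continuous_intros)
  ultimately show ?thesis
    using lim \<sigma> by (simp add: tendsto_complex_iff Re Im weakly_converges_on_def)
qed

lemma weakly_converges_on_total_mass:
  assumes "\<And>n. finite_borel_measure (\<sigma> n)" "finite_borel_measure \<sigma>'"
    and "weakly_converges_on UNIV \<sigma> \<sigma>'"
  shows "(\<lambda>n. measure (\<sigma> n) UNIV) \<longlonglongrightarrow> measure \<sigma>' UNIV"
proof -
  have "(\<lambda>n. LINT x|\<sigma> n. (1::real)) \<longlonglongrightarrow> (LINT x|\<sigma>'. 1)"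
    using assms(3)[unfolded weakly_converges_on_def, rule_format, of "\<lambda>_. 1"] by simp
  then show ?thesis
    using finite_borel_measure_space[OF assms(1)] finite_borel_measure_space[OF assms(2)] by simp
qed

lemma upper_half_plane_minus_real:
  assumes "z \<in> upper_half_plane"
  shows "z - of_real x \<noteq> 0" "Im z \<le> norm (z - of_real x)"
  using assms abs_Im_le_cmod[of "z - of_real x"] by (auto simp: upper_half_plane_def complex_eq_iff)

lemma norm_cauchy_kernel_le:
  assumes "z \<in> upper_half_plane"
  shows "norm (1 / (z - of_real x)) \<le> 1 / Im z"
  using upper_half_plane_minus_real[OF assms, of x] assms
  by (simp add: norm_divide divide_simps upper_half_plane_def)

lemma continuous_cauchy_kernel:
  assumes "z \<in> upper_half_plane"
  shows "continuous_on UNIV (\<lambda>x::real. 1 / (z - of_real x))"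
  using upper_half_plane_minus_real[OF assms] by (intro continuous_intros) auto

lemma bounded_cauchy_kernel:
  assumes "z \<in> upper_half_plane"
  shows "bounded (range (\<lambda>x::real. 1 / (z - of_real x)))"
  using norm_cauchy_kernel_le[OF assms] unfolding bounded_iff by blast

lemma norm_cauchy_transform_le:
  assumes "finite_borel_measure \<sigma>" "z \<in> upper_half_plane"
  shows "norm (cauchy_transform \<sigma> z) \<le> measure \<sigma> UNIV / Im z"
  using finite_borel_measure.norm_integral_le[OF assms(1) continuous_cauchy_kernel[OF assms(2)] norm_cauchy_kernel_le[OF assms(2)]]
  by (simp add: cauchy_transform_def)

text \<open>The estimate depends on the measure only through its total mass. Hence the point \<open>z\<close> may vary
  together with the measure in the limits below.\<close>

lemma cauchy_transform_lipschitz: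
  assumes \<sigma>: "finite_borel_measure \<sigma>" and z: "z \<in> upper_half_plane" and w: "w \<in> upper_half_plane"
  shows "norm (cauchy_transform \<sigma> w - cauchy_transform \<sigma> z) \<le> norm (w - z) / (Im w * Im z) * measure \<sigma> UNIV"
proof -
  interpret finite_borel_measure \<sigma> by fact
  have int: "integrable \<sigma> (\<lambda>x. 1 / (v - of_real x))" if "v \<in> upper_half_plane" for v :: complex
    using continuous_cauchy_kernel[OF that] bounded_cauchy_kernel[OF that] by (rule integrable_bounded_continuous)
  have "norm (1 / (w - of_real x) - 1 / (z - of_real x)) \<le> norm (w - z) / (Im w * Im z)" for x
  proof -
    have "norm (1 / (w - of_real x) - 1 / (z - of_real x)) = norm ((z - w) * (1 / (w - of_real x)) * (1 / (z - of_real x)))"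
      using upper_half_plane_minus_real[OF z, of x] upper_half_plane_minus_real[OF w, of x]
      by (intro arg_cong[of _ _ norm]) (simp add: field_simps)
    also have "\<dots> \<le> norm (z - w) * (1 / Im w) * (1 / Im z)"
      unfolding norm_mult using z w
      by (intro mult_mono norm_cauchy_kernel_le) (auto simp: upper_half_plane_def)
    finally show ?thesis by (simp add: norm_minus_commute)
  qed
  then have "norm (LINT x|\<sigma>. 1 / (w - of_real x) - 1 / (z - of_real x)) \<le> norm (w - z) / (Im w * Im z) * measure \<sigma> UNIV"
    by (intro norm_integral_le continuous_on_diff continuous_cauchy_kernel z w) auto
  then show ?thesis
    using int z w by (simp add: cauchy_transform_def)
qed

lemma cauchy_transform_tendsto:
  assumes \<sigma>: "\<And>n. finite_borel_measure (\<sigma> n)" "finite_borel_measure \<sigma>'"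
    and lim: "weakly_converges_on UNIV \<sigma> \<sigma>'"
    and z: "\<And>n. z n \<in> upper_half_plane" "z \<longlonglongrightarrow> z'" "z' \<in> upper_half_plane"
  shows "(\<lambda>n. cauchy_transform (\<sigma> n) (z n)) \<longlonglongrightarrow> cauchy_transform \<sigma>' z'"
proof -
  have "(\<lambda>n. cauchy_transform (\<sigma> n) z') \<longlonglongrightarrow> cauchy_transform \<sigma>' z'"
    unfolding cauchy_transform_def
    using continuous_cauchy_kernel[OF z(3)] bounded_cauchy_kernel[OF z(3)]
    by (rule weakly_converges_onD_complex[OF \<sigma> lim])
  moreover have "(\<lambda>n. cauchy_transform (\<sigma> n) (z n) - cauchy_transform (\<sigma> n) z') \<longlonglongrightarrow> 0"
  proof (rule Lim_null_comparison)
    show "\<forall>\<^sub>F n in sequentially. norm (cauchy_transform (\<sigma> n) (z n) - cauchy_transform (\<sigma> n) z')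
        \<le> norm (z n - z') / (Im (z n) * Im z') * measure (\<sigma> n) UNIV"
      by (intro always_eventually allI cauchy_transform_lipschitz \<sigma> z)
    have "(\<lambda>n. norm (z n - z') / (Im (z n) * Im z') * measure (\<sigma> n) UNIV)
        \<longlonglongrightarrow> norm (z' - z') / (Im z' * Im z') * measure \<sigma>' UNIV"
      using z(3) by (intro tendsto_intros z(2) weakly_converges_on_total_mass \<sigma> lim) (auto simp: upper_half_plane_def)
    then show "(\<lambda>n. norm (z n - z') / (Im (z n) * Im z') * measure (\<sigma> n) UNIV) \<longlonglongrightarrow> 0"
      by simp
  qed
  ultimately show ?thesis
    by (rule Lim_transform)
qed

text \<open>The kernel of the Nevanlinna representation of Pick functions. It is bounded in \<open>x\<close>, so the
  transform is defined for every finite measure.\<close>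

definition nevanlinna_transform :: "real measure \<Rightarrow> complex \<Rightarrow> complex" where
  "nevanlinna_transform \<sigma> z = (LINT x|\<sigma>. (1 + of_real x * z) / (z - of_real x))"

lemma nevanlinna_kernel_eq:
  assumes "z \<in> upper_half_plane"
  shows "(1 + of_real x * z) / (z - of_real x) = (1 + z\<^sup>2) * (1 / (z - of_real x)) - z"
  using upper_half_plane_minus_real[OF assms, of x] by (simp add: field_simps power2_eq_square)

lemma integrable_nevanlinna_kernel:
  assumes \<sigma>: "finite_borel_measure \<sigma>" and z: "z \<in> upper_half_plane"
  shows "integrable \<sigma> (\<lambda>x. (1 + of_real x * z) / (z - of_real x))"
proof -
  interpret finite_borel_measure \<sigma> by fact
  have "integrable \<sigma> (\<lambda>x. 1 / (z - of_real x))"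
    using continuous_cauchy_kernel[OF z] bounded_cauchy_kernel[OF z] by (rule integrable_bounded_continuous)
  then show ?thesis
    unfolding nevanlinna_kernel_eq[OF z] by (intro Bochner_Integration.integrable_diff integrable_mult_right) auto
qed

text \<open>Links the generator side, which uses the Nevanlinna kernel, to the law side, which uses the
  Cauchy transform.\<close>

lemma nevanlinna_transform_eq_cauchy_transform:
  assumes \<sigma>: "finite_borel_measure \<sigma>" and z: "z \<in> upper_half_plane"
  shows "nevanlinna_transform \<sigma> z = (1 + z\<^sup>2) * cauchy_transform \<sigma> z - z * of_real (measure \<sigma> UNIV)"
proof -
  interpret finite_borel_measure \<sigma> by fact
  have int: "integrable \<sigma> (\<lambda>x. 1 / (z - of_real x))"
    using continuous_cauchy_kernel[OF z] bounded_cauchy_kernel[OF z] by (rule integrable_bounded_continuous)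
  have "nevanlinna_transform \<sigma> z = (LINT x|\<sigma>. (1 + z\<^sup>2) * (1 / (z - of_real x))) - (LINT x|\<sigma>. z)"
    unfolding nevanlinna_transform_def nevanlinna_kernel_eq[OF z]
    by (intro Bochner_Integration.integral_diff integrable_mult_right int integrable_const)
  also have "(LINT x|\<sigma>. (1 + z\<^sup>2) * (1 / (z - of_real x))) = (1 + z\<^sup>2) * cauchy_transform \<sigma> z"
    unfolding cauchy_transform_def by (rule integral_mult_right_zero)
  also have "(LINT x|\<sigma>. z) = z * of_real (measure \<sigma> UNIV)"
    by (simp add: finite_borel_measure_space[OF \<sigma>] scaleR_conv_of_real mult.commute)
  finally show ?thesis .
qed

lemma nevanlinna_transform_tendsto:
  assumes \<sigma>: "\<And>n. finite_borel_measure (\<sigma> n)" "finite_borel_measure \<sigma>'"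
    and lim: "weakly_converges_on UNIV \<sigma> \<sigma>'"
    and z: "\<And>n. z n \<in> upper_half_plane" "z \<longlonglongrightarrow> z'" "z' \<in> upper_half_plane"
  shows "(\<lambda>n. nevanlinna_transform (\<sigma> n) (z n)) \<longlonglongrightarrow> nevanlinna_transform \<sigma>' z'"
  unfolding nevanlinna_transform_eq_cauchy_transform[OF \<sigma>(1) z(1)]
    nevanlinna_transform_eq_cauchy_transform[OF \<sigma>(2) z(3)]
  by (intro tendsto_intros cauchy_transform_tendsto weakly_converges_on_total_mass \<sigma> lim z)

lemma norm_nevanlinna_transform_le:
  assumes \<sigma>: "finite_borel_measure \<sigma>" and z: "z \<in> upper_half_plane"
  shows "norm (nevanlinna_transform \<sigma> z) \<le> (norm (1 + z\<^sup>2) / Im z + norm z) * measure \<sigma> UNIV"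
proof -
  have "norm (nevanlinna_transform \<sigma> z) \<le> norm (1 + z\<^sup>2) * norm (cauchy_transform \<sigma> z) + norm z * measure \<sigma> UNIV"
    unfolding nevanlinna_transform_eq_cauchy_transform[OF \<sigma> z]
    by (rule order_trans[OF norm_triangle_ineq4]) (simp add: norm_mult)
  also have "\<dots> \<le> norm (1 + z\<^sup>2) * (measure \<sigma> UNIV / Im z) + norm z * measure \<sigma> UNIV"
    by (intro add_mono mult_left_mono norm_cauchy_transform_le \<sigma> z) auto
  finally show ?thesis by (simp add: algebra_simps)
qed

text \<open>The imaginary part is \<open>- Im z (1 + x\<^sup>2) / \<bar>z - x\<bar>\<^sup>2\<close>, and the Cauchy-Schwarz inequality gives
  \<open>\<bar>z - x\<bar>\<^sup>2 \<le> (1 + x\<^sup>2) (1 + \<bar>z\<bar>\<^sup>2)\<close>.\<close>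

lemma Im_nevanlinna_kernel_le:
  assumes z: "z \<in> upper_half_plane"
  shows "Im ((1 + of_real x * z) / (z - of_real x)) \<le> - (Im z / (1 + (norm z)\<^sup>2))"
proof -
  have nz: "z - of_real x \<noteq> 0" by (rule upper_half_plane_minus_real[OF z])
  have "Im ((1 + of_real x * z) / (z - of_real x)) = - (Im z * (1 + x\<^sup>2) / (norm (z - of_real x))\<^sup>2)"
  proof -
    have num: "Im (1 + of_real x * z) * Re (z - of_real x) - Re (1 + of_real x * z) * Im (z - of_real x)
        = - (Im z * (1 + x\<^sup>2))"
      by (simp add: power2_eq_square algebra_simps)
    have "Im ((1 + of_real x * z) / (z - of_real x)) = - (Im z * (1 + x\<^sup>2)) / (norm (z - of_real x))\<^sup>2"
      unfolding num[symmetric] by (simp only: Im_divide cmod_power2)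
    then show ?thesis by simp
  qed
  moreover have "Im z / (1 + (norm z)\<^sup>2) \<le> Im z * (1 + x\<^sup>2) / (norm (z - of_real x))\<^sup>2"
  proof -
    have "norm (z - of_real x) \<le> norm z + \<bar>x\<bar>"
      using norm_triangle_ineq4[of z "of_real x"] by simp
    then have "(norm (z - of_real x))\<^sup>2 \<le> (norm z + \<bar>x\<bar>)\<^sup>2"
      by (intro power_mono) auto
    \<comment> \<open>The added square turns the sum into the product of Lagrange's identity.\<close>
    also have "\<dots> \<le> (norm z + \<bar>x\<bar>)\<^sup>2 + (1 - norm z * \<bar>x\<bar>)\<^sup>2"
      by simp
    also have "\<dots> = (1 + x\<^sup>2) * (1 + (norm z)\<^sup>2)"
      by (simp add: power2_eq_square algebra_simps)
    finally have *: "(norm (z - of_real x))\<^sup>2 \<le> (1 + x\<^sup>2) * (1 + (norm z)\<^sup>2)" .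
    have "0 < 1 + (norm z)\<^sup>2"
      by (simp add: add_pos_nonneg)
    then have "Im z * (norm (z - of_real x))\<^sup>2 \<le> Im z * (1 + x\<^sup>2) * (1 + (norm z)\<^sup>2)"
      using mult_left_mono[OF *, of "Im z"] z by (simp add: upper_half_plane_def mult.assoc)
    then show ?thesis
      using nz \<open>0 < 1 + (norm z)\<^sup>2\<close> by (simp add: divide_le_eq pos_le_divide_eq mult.commute)
  qed
  ultimately show ?thesis by simp
qed

text \<open>The value at one point controls the total mass. This is what keeps a sequence of measures bounded
  when nothing but convergence of the transforms is known.\<close>

lemma measure_UNIV_le_nevanlinna_transform:
  assumes \<sigma>: "finite_borel_measure \<sigma>" and z: "z \<in> upper_half_plane"
  shows "Im z / (1 + (norm z)\<^sup>2) * measure \<sigma> UNIV \<le> - Im (nevanlinna_transform \<sigma> z)"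
proof -
  interpret finite_borel_measure \<sigma> by fact
  note int = integrable_nevanlinna_kernel[OF \<sigma> z]
  have "Im (nevanlinna_transform \<sigma> z) = (LINT x|\<sigma>. Im ((1 + of_real x * z) / (z - of_real x)))"
    unfolding nevanlinna_transform_def by (rule integral_bounded_linear[OF bounded_linear_Im int, symmetric])
  also have "\<dots> \<le> (LINT x|\<sigma>. - (Im z / (1 + (norm z)\<^sup>2)))"
    by (rule integral_mono) (use integrable_bounded_linear[OF bounded_linear_Im int] Im_nevanlinna_kernel_le[OF z] in simp_all)
  also have "\<dots> = - (Im z / (1 + (norm z)\<^sup>2)) * measure \<sigma> UNIV"
    by (simp add: finite_borel_measure_space[OF \<sigma>])
  finally show ?thesis by simp
qed

text \<open>The kernel \<open>1 / (z - x)\<close> has negative imaginary part, so its integral against a nonzero measure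
  cannot vanish.\<close>

lemma cauchy_transform_nonzero:
  assumes \<mu>: "real_distribution \<mu>" and z: "z \<in> upper_half_plane"
  shows "cauchy_transform \<mu> z \<noteq> 0"
proof
  assume 0: "cauchy_transform \<mu> z = 0"
  interpret real_distribution \<mu> by fact
  have int: "integrable \<mu> (\<lambda>x. 1 / (z - of_real x))"
    using continuous_cauchy_kernel[OF z] bounded_cauchy_kernel[OF z] by (rule integrable_bounded_continuous)
  have pos: "0 < - Im (1 / (z - of_real x))" for x
    using z upper_half_plane_minus_real(1)[OF z, of x]
    by (auto simp: Im_divide upper_half_plane_def complex_eq_iff intro!: divide_pos_pos add_nonneg_pos)
  have "(LINT x|\<mu>. - Im (1 / (z - of_real x))) = - Im (cauchy_transform \<mu> z)"
    unfolding cauchy_transform_def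
    using integral_bounded_linear[OF bounded_linear_Im int] by simp
  also have "\<dots> = 0"
    using 0 by simp
  finally have "AE x in \<mu>. - Im (1 / (z - of_real x)) = 0"
    by (subst (asm) integral_nonneg_eq_0_iff_AE)
      (use integrable_bounded_linear[OF bounded_linear_Im int] pos in \<open>auto intro: less_imp_le\<close>)
  moreover have "- Im (1 / (z - of_real x)) \<noteq> 0" for x
    using pos[of x] by linarith
  ultimately have "AE x in \<mu>. False"
    by (simp only:)
  then show False
    by (simp add: AE_False)
qed

section \<open>Trigonometric moments on the unit circle\<close>

text \<open>The real line is mapped onto the unit circle without the point \<open>1\<close>, which stands for infinity. The
  map is the complex conjugate of the boundary values of \<open>(z - \<i>) / (z + \<i>)\<close>; with this choice the
  Nevanlinna kernel expands into nonnegative powers.\<close>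

definition circle_map :: "real \<Rightarrow> complex" where
  "circle_map x = (of_real x + \<i>) / (of_real x - \<i>)"

lemma circle_map_denominator: "of_real x - \<i> \<noteq> 0"
  by (simp add: complex_eq_iff)

lemma norm_circle_map [simp]: "norm (circle_map x) = 1"
proof -
  have "norm (of_real x + \<i>) = norm (of_real x - \<i>)"
    by (simp add: cmod_def)
  then show ?thesis
    using circle_map_denominator[of x] by (simp add: circle_map_def norm_divide)
qed

lemma circle_map_nonzero [simp]: "circle_map x \<noteq> 0"
  using norm_circle_map[of x] by (metis norm_zero zero_neq_one)

lemma continuous_circle_map: "continuous_on UNIV circle_map"
  unfolding circle_map_def using circle_map_denominator by (intro continuous_intros) auto

lemma cnj_circle_map: "cnj (circle_map x) = inverse (circle_map x)"
  by (simp add: circle_map_def)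

definition moment :: "real measure \<Rightarrow> int \<Rightarrow> complex" where
  "moment \<sigma> k = (LINT x|\<sigma>. circle_map x powi k)"

lemma continuous_circle_map_powi: "continuous_on UNIV (\<lambda>x. circle_map x powi k)"
  by (intro continuous_intros continuous_circle_map) simp

lemma norm_circle_map_powi: "norm (circle_map x powi k) = 1"
  by (simp add: norm_power_int)

lemma norm_moment_le: "finite_borel_measure \<sigma> \<Longrightarrow> norm (moment \<sigma> k) \<le> measure \<sigma> UNIV"
  using finite_borel_measure.norm_integral_le[OF _ continuous_circle_map_powi, of \<sigma> k 1]
  by (simp add: moment_def norm_circle_map_powi)

lemma moment_0: "finite_borel_measure \<sigma> \<Longrightarrow> moment \<sigma> 0 = of_real (measure \<sigma> UNIV)"
  using finite_borel_measure_space[of \<sigma>] by (simp add: moment_def scaleR_conv_of_real)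

lemma moment_uminus: "moment \<sigma> (- k) = cnj (moment \<sigma> k)"
proof -
  have "circle_map x powi (- k) = cnj (circle_map x powi k)" for x
    by (cases k rule: int_cases2) (simp_all add: power_int_minus cnj_circle_map power_inverse)
  then show ?thesis
    unfolding moment_def by (simp only: Bochner_Integration.integral_cnj)
qed

definition cayley :: "complex \<Rightarrow> complex" where
  "cayley z = (z - \<i>) / (z + \<i>)"

lemma cayley_denominator: "z \<in> upper_half_plane \<Longrightarrow> z + \<i> \<noteq> 0"
  by (auto simp: upper_half_plane_def complex_eq_iff)

lemma norm_cayley_less_1:
  assumes "z \<in> upper_half_plane"
  shows "norm (cayley z) < 1"
proof -
  have "(norm (z - \<i>))\<^sup>2 < (norm (z + \<i>))\<^sup>2"
    using assms unfolding cmod_power2 by (simp add: upper_half_plane_def power2_eq_square algebra_simps)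
  then have "norm (z - \<i>) < norm (z + \<i>)"
    by (rule power_less_imp_less_base) simp
  then show ?thesis
    using cayley_denominator[OF assms] by (simp add: cayley_def norm_divide)
qed

lemma inj_on_cayley: "inj_on cayley upper_half_plane"
proof (rule inj_onI)
  fix z w assume "z \<in> upper_half_plane" "w \<in> upper_half_plane" "cayley z = cayley w"
  then have "(z - \<i>) * (w + \<i>) = (w - \<i>) * (z + \<i>)"
    using cayley_denominator[of z] cayley_denominator[of w] by (simp add: cayley_def frac_eq_eq)
  then have "2 * \<i> * z = 2 * \<i> * w"
    by (simp add: algebra_simps)
  then show "z = w" by simp
qed

lemma islimpt_cayley_image:
  assumes A: "A \<subseteq> upper_half_plane" and z: "z \<in> upper_half_plane" "z islimpt A"
  shows "cayley z islimpt cayley ` A"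
proof -
  obtain f where f: "\<And>n. f n \<in> A - {z}" "f \<longlonglongrightarrow> z"
    using z(2) by (auto simp: islimpt_sequential)
  have "(\<lambda>n. cayley (f n)) \<longlonglongrightarrow> cayley z"
    unfolding cayley_def by (intro tendsto_intros f cayley_denominator z)
  moreover have "cayley (f n) \<in> cayley ` A - {cayley z}" for n
    using f(1)[of n] A z(1) inj_on_cayley by (auto dest: inj_onD)
  ultimately show ?thesis
    unfolding islimpt_sequential by (intro exI[of _ "\<lambda>n. cayley (f n)"]) simp
qed

text \<open>With \<open>q = circle_map x * cayley z\<close> the kernel equals \<open>- \<i> (1 + q) / (1 - q)\<close>, the Herglotz kernel of the
  disc, and the expansion is a geometric series. Its constant term is half of what the other terms
  would suggest, which accounts for the case distinction.\<close>

lemma nevanlinna_kernel_sums: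
  assumes z: "z \<in> upper_half_plane"
  shows "(\<lambda>k. (if k = 0 then - \<i> else - 2 * \<i>) * circle_map x ^ k * cayley z ^ k) sums
    ((1 + of_real x * z) / (z - of_real x))"
proof -
  let ?q = "circle_map x * cayley z"
  have q: "norm ?q < 1"
    using norm_cayley_less_1[OF z] by (simp add: norm_mult)
  then have "?q \<noteq> 1" by auto
  have "(\<lambda>k. - 2 * \<i> * ?q ^ k) sums (- 2 * \<i> * (1 / (1 - ?q)))"
    by (intro sums_mult geometric_sums q)
  \<comment> \<open>Corrects the constant term.\<close>
  moreover have "(\<lambda>k. if k = 0 then \<i> else 0) sums \<i>"
    using sums_If_finite_set[of "{0::nat}" "\<lambda>_. \<i>"] by simp
  ultimately have "(\<lambda>k. - 2 * \<i> * ?q ^ k + (if k = 0 then \<i> else 0)) sums (- 2 * \<i> * (1 / (1 - ?q)) + \<i>)"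
    by (rule sums_add)
  moreover have "- 2 * \<i> * (1 / (1 - ?q)) + \<i> = (1 + of_real x * z) / (z - of_real x)"
  proof -
    have nz: "of_real x - \<i> \<noteq> 0" "z + \<i> \<noteq> 0" "z - of_real x \<noteq> 0"
      using circle_map_denominator cayley_denominator[OF z] upper_half_plane_minus_real[OF z] by auto
    have "1 - ?q = ((of_real x - \<i>) * (z + \<i>) - (of_real x + \<i>) * (z - \<i>)) / ((of_real x - \<i>) * (z + \<i>))"
    proof -
      have "?q = (of_real x + \<i>) * (z - \<i>) / ((of_real x - \<i>) * (z + \<i>))"
        by (simp add: circle_map_def cayley_def)
      moreover have "1 = (of_real x - \<i>) * (z + \<i>) / ((of_real x - \<i>) * (z + \<i>))"
        using nz by simp
      ultimately show ?thesis
        by (metis diff_divide_distrib)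
    qed
    also have "(of_real x - \<i>) * (z + \<i>) - (of_real x + \<i>) * (z - \<i>) = 2 * \<i> * (of_real x - z)"
      by (simp add: algebra_simps)
    finally have eq: "1 - ?q = 2 * \<i> * (of_real x - z) / ((of_real x - \<i>) * (z + \<i>))" .
    have "- 2 * \<i> * (1 / (1 - ?q)) + \<i> = ((of_real x - \<i>) * (z + \<i>)) / (z - of_real x) + \<i>"
      unfolding eq using nz by (simp add: divide_simps) (simp add: algebra_simps)
    also have "\<dots> = (1 + of_real x * z) / (z - of_real x)"
      using nz by (simp add: field_simps)
    finally show ?thesis .
  qed
  moreover have "(\<lambda>k. - 2 * \<i> * ?q ^ k + (if k = 0 then \<i> else 0)) =
      (\<lambda>k. (if k = 0 then - \<i> else - 2 * \<i>) * circle_map x ^ k * cayley z ^ k)"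
    by (auto simp: power_mult_distrib)
  ultimately show ?thesis by simp
qed

lemma nevanlinna_transform_sums:
  assumes \<sigma>: "finite_borel_measure \<sigma>" and z: "z \<in> upper_half_plane"
  shows "(\<lambda>k. (if k = 0 then - \<i> else - 2 * \<i>) * moment \<sigma> (int k) * cayley z ^ k) sums nevanlinna_transform \<sigma> z"
proof -
  interpret finite_borel_measure \<sigma> by fact
  define f where "f k x = (if k = 0 then - \<i> else - 2 * \<i>) * circle_map x ^ k * cayley z ^ k" for k x
  have nf: "norm (f k x) \<le> 2 * norm (cayley z) ^ k" for k x
    by (simp add: f_def norm_mult norm_power)
  have cont: "continuous_on UNIV (f k)" for k
    unfolding f_def by (intro continuous_intros continuous_circle_map)
  have int: "integrable \<sigma> (f k)" for k
    using cont nf[of k] by (intro integrable_bounded_continuous) (auto simp: bounded_iff)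
  have "(\<lambda>k. integral\<^sup>L \<sigma> (f k)) sums (LINT x|\<sigma>. (\<Sum>k. f k x))"
  proof (rule sums_integral[OF int])
    have geo: "summable (\<lambda>k. 2 * norm (cayley z) ^ k)"
      using norm_cayley_less_1[OF z] by (intro summable_mult summable_geometric) auto
    show "AE x in \<sigma>. summable (\<lambda>k. norm (f k x))"
      using nf by (intro AE_I2 summable_comparison_test[OF _ geo]) auto
    have "(LINT x|\<sigma>. norm (f k x)) \<le> 2 * norm (cayley z) ^ k * measure \<sigma> UNIV" for k
    proof -
      have "(LINT x|\<sigma>. norm (f k x)) \<le> (LINT x|\<sigma>. 2 * norm (cayley z) ^ k)"
        using int[of k] nf[of k] by (intro integral_mono) auto
      then show ?thesis
        by (simp add: finite_borel_measure_space[OF \<sigma>] mult_ac)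
    qed
    then show "summable (\<lambda>k. LINT x|\<sigma>. norm (f k x))"
      by (intro summable_comparison_test[OF _ summable_mult2[OF geo, of "measure \<sigma> UNIV"]]) auto
  qed
  moreover have "integral\<^sup>L \<sigma> (f k) = (if k = 0 then - \<i> else - 2 * \<i>) * moment \<sigma> (int k) * cayley z ^ k" for k
    unfolding f_def moment_def by simp
  moreover have "(\<Sum>k. f k x) = (1 + of_real x * z) / (z - of_real x)" for x
    using sums_unique[OF nevanlinna_kernel_sums[OF z, of x]] by (simp add: f_def)
  ultimately show ?thesis
    by (simp add: nevanlinna_transform_def)
qed

text \<open>The coefficients of the power series in \<open>cayley z\<close> are \<open>\<gamma> - \<i> \<sigma>(UNIV)\<close> and, for \<open>k > 0\<close>, a multiple of
  the \<open>k\<close>-th moment. As \<open>\<gamma>\<close> and the total mass are real, the first coefficient determines both.\<close>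

lemma moments_tendsto:
  fixes \<gamma> :: "nat \<Rightarrow> real"
  assumes \<sigma>: "\<And>n. finite_borel_measure (\<sigma> n)" "finite_borel_measure \<sigma>'"
    and A: "A \<subseteq> upper_half_plane" "z0 \<in> upper_half_plane" "z0 islimpt A"
    and lim: "\<And>z. z \<in> A \<Longrightarrow> (\<lambda>n. of_real (\<gamma> n) + nevanlinna_transform (\<sigma> n) z)
                \<longlonglongrightarrow> of_real \<gamma>' + nevanlinna_transform \<sigma>' z"
  shows "\<gamma> \<longlonglongrightarrow> \<gamma>'" "(\<lambda>n. moment (\<sigma> n) k) \<longlonglongrightarrow> moment \<sigma>' k"
proof -
  obtain w where w: "w \<in> A"
    using A(3) by (metis all_not_in_conv islimpt_EMPTY)
  then have w': "w \<in> upper_half_plane" using A by auto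
  \<comment> \<open>One point of \<open>A\<close> suffices to bound the masses and the constants uniformly in \<open>n\<close>, which
    the convergence of the power series coefficients requires.\<close>
  obtain C where C: "\<And>n. norm (of_real (\<gamma> n) + nevanlinna_transform (\<sigma> n) w) \<le> C"
    using convergent_imp_Bseq[OF convergentI[OF lim[OF w]]] by (auto simp: Bseq_def)
  define c where "c = Im w / (1 + (norm w)\<^sup>2)"
  have c: "c > 0"
    using w' by (auto simp: c_def upper_half_plane_def intro!: divide_pos_pos add_pos_nonneg)
  have mass: "measure (\<sigma> n) UNIV \<le> C / c" for n
  proof -
    have "c * measure (\<sigma> n) UNIV \<le> - Im (nevanlinna_transform (\<sigma> n) w)"
      unfolding c_def by (rule measure_UNIV_le_nevanlinna_transform[OF \<sigma>(1) w'])
    also have "\<dots> = - Im (of_real (\<gamma> n) + nevanlinna_transform (\<sigma> n) w)"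
      by simp
    also have "\<dots> \<le> C"
      using abs_Im_le_cmod C[of n] by (smt (verit))
    finally show ?thesis
      using c by (simp add: pos_le_divide_eq mult.commute)
  qed
  define d where "d = norm (1 + w\<^sup>2) / Im w + norm w"
  have d: "d \<ge> 0"
    using w' by (auto simp: d_def upper_half_plane_def)
  have drift: "\<bar>\<gamma> n\<bar> \<le> C + d * (C / c)" for n
  proof -
    have "norm (complex_of_real (\<gamma> n)) \<le> norm (of_real (\<gamma> n) + nevanlinna_transform (\<sigma> n) w) + norm (nevanlinna_transform (\<sigma> n) w)"
      using norm_triangle_ineq4[of "of_real (\<gamma> n) + nevanlinna_transform (\<sigma> n) w" "nevanlinna_transform (\<sigma> n) w"] by simp
    also have "\<dots> \<le> C + d * measure (\<sigma> n) UNIV"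
      unfolding d_def by (intro add_mono C norm_nevanlinna_transform_le \<sigma> w')
    also have "\<dots> \<le> C + d * (C / c)"
      using d mass by (intro add_mono mult_left_mono) auto
    finally show ?thesis by simp
  qed
  define coeff where "coeff \<delta> \<mu> k = (if k = 0 then of_real \<delta> - \<i> * moment \<mu> 0 else - 2 * \<i> * moment \<mu> (int k))"
    for \<delta> :: real and \<mu> :: "real measure" and k :: nat
  have norm_coeff: "norm (coeff \<delta> \<mu> k) \<le> \<bar>\<delta>\<bar> + 2 * measure \<mu> UNIV" if "finite_borel_measure \<mu>" for \<delta> \<mu> k
  proof (cases "k = 0")
    case True
    have "norm (coeff \<delta> \<mu> k) \<le> \<bar>\<delta>\<bar> + norm (moment \<mu> 0)"
      using norm_triangle_ineq4[of "of_real \<delta>" "\<i> * moment \<mu> 0"] True by (simp add: coeff_def norm_mult)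
    then show ?thesis
      using norm_moment_le[OF that, of 0] measure_nonneg[of \<mu> UNIV] by linarith
  next
    case False
    then show ?thesis
      using norm_moment_le[OF that, of "int k"] by (simp add: coeff_def norm_mult)
  qed
  have expansion: "(\<Sum>k. coeff \<delta> \<mu> k * cayley z ^ k) = of_real \<delta> + nevanlinna_transform \<mu> z"
    if "finite_borel_measure \<mu>" "z \<in> A" for \<delta> \<mu> z
  proof -
    have "z \<in> upper_half_plane" using A that by auto
    have "(\<lambda>k. if k = 0 then of_real \<delta> else 0) sums (of_real \<delta> :: complex)"
      using sums_If_finite_set[of "{0::nat}" "\<lambda>_. of_real \<delta> :: complex"] by simp
    from sums_add[OF this nevanlinna_transform_sums[OF that(1) \<open>z \<in> upper_half_plane\<close>]]
    have "(\<lambda>k. coeff \<delta> \<mu> k * cayley z ^ k) sums (of_real \<delta> + nevanlinna_transform \<mu> z)"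
      by (rule back_subst[of "\<lambda>f. f sums _"]) (auto simp: coeff_def)
    then show ?thesis
      by (rule sums_unique[symmetric])
  qed
  define M where "M = max (C + d * (C / c) + 2 * (C / c)) (\<bar>\<gamma>'\<bar> + 2 * measure \<sigma>' UNIV)"
  have coeff_lim: "(\<lambda>n. coeff (\<gamma> n) (\<sigma> n) k) \<longlonglongrightarrow> coeff \<gamma>' \<sigma>' k" for k
  proof (rule power_series_coefficients_tendsto)
    show "norm (coeff (\<gamma> n) (\<sigma> n) k) \<le> M" for n k
    proof -
      have "norm (coeff (\<gamma> n) (\<sigma> n) k) \<le> C + d * (C / c) + 2 * (C / c)"
        using norm_coeff[OF \<sigma>(1)[of n], of "\<gamma> n" k] drift[of n] mass[of n] by linarith
      then show ?thesis by (simp add: M_def)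
    qed
    show "norm (coeff \<gamma>' \<sigma>' k) \<le> M" for k
      using norm_coeff[OF \<sigma>(2), of \<gamma>' k] by (simp add: M_def)
    show "cayley ` A \<subseteq> ball 0 1" "cayley z0 \<in> ball 0 1"
      using norm_cayley_less_1 A by auto
    show "cayley z0 islimpt cayley ` A"
      by (rule islimpt_cayley_image[OF A])
    show "(\<lambda>n. \<Sum>k. coeff (\<gamma> n) (\<sigma> n) k * z ^ k) \<longlonglongrightarrow> (\<Sum>k. coeff \<gamma>' \<sigma>' k * z ^ k)" if "z \<in> cayley ` A" for z
      using that lim by (auto simp: expansion \<sigma>)
  qed
  show "\<gamma> \<longlonglongrightarrow> \<gamma>'"
    using tendsto_Re[OF coeff_lim[of 0]] by (simp add: coeff_def moment_0 \<sigma>)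
  have nonneg: "(\<lambda>n. moment (\<sigma> n) (int k)) \<longlonglongrightarrow> moment \<sigma>' (int k)" for k
  proof (cases "k = 0")
    case True
    then show ?thesis
      using tendsto_of_real[OF tendsto_minus[OF tendsto_Im[OF coeff_lim[of 0]]]]
      by (simp add: coeff_def moment_0 \<sigma>)
  next
    case False
    then show ?thesis
      using tendsto_mult_left[OF coeff_lim[of k], of "\<i> / 2"] by (simp add: coeff_def)
  qed
  show "(\<lambda>n. moment (\<sigma> n) k) \<longlonglongrightarrow> moment \<sigma>' k"
  proof (cases "k \<ge> 0")
    case True
    then show ?thesis using nonneg[of "nat k"] by simp
  next
    case False
    then obtain j where "k = - int j"
      by (metis int_cases2 int_nat_eq of_nat_0_le_iff)
    then show ?thesis
      by (simp add: moment_uminus tendsto_cnj nonneg)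
  qed
qed

section \<open>From moments to weak convergence\<close>

text \<open>The errors may depend on \<open>n\<close>, as long as they converge to something small. This covers errors
  that are integrals against the measures of the sequence.\<close>

lemma tendsto_by_approximation:
  fixes a :: "nat \<Rightarrow> real"
  assumes "\<And>e. e > 0 \<Longrightarrow> \<exists>b b' d d'. b \<longlonglongrightarrow> b' \<and> d \<longlonglongrightarrow> d' \<and>
     (\<forall>n. \<bar>a n - b n\<bar> \<le> d n) \<and> \<bar>a' - b'\<bar> \<le> d' \<and> d' < e"
  shows "a \<longlonglongrightarrow> a'"
proof (rule tendstoI)
  fix e :: real assume "e > 0"
  then obtain b b' d d' where b: "b \<longlonglongrightarrow> b'" and d: "d \<longlonglongrightarrow> d'"
    and close: "\<And>n. \<bar>a n - b n\<bar> \<le> d n" "\<bar>a' - b'\<bar> \<le> d'" and small: "d' < e / 3"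
    using assms[of "e / 3"] by auto
  have "\<forall>\<^sub>F n in sequentially. dist (b n) b' < e / 3"
    using b \<open>e > 0\<close> by (intro tendstoD) auto
  moreover have "\<forall>\<^sub>F n in sequentially. d n < e / 3"
    using d small by (rule order_tendstoD)
  ultimately show "\<forall>\<^sub>F n in sequentially. dist (a n) a' < e"
  proof eventually_elim
    case (elim n)
    then show ?case
      using close(1)[of n] close(2) small unfolding dist_real_def by linarith
  qed
qed

lemma bounded_range_mult:
  fixes f g :: "'a \<Rightarrow> 'b::real_normed_algebra"
  assumes "bounded (range f)" "bounded (range g)"
  shows "bounded (range (\<lambda>x. f x * g x))"
proof -
  obtain A B where "\<And>x. norm (f x) \<le> A" "\<And>x. norm (g x) \<le> B"
    using assms unfolding bounded_iff by auto
  then have "norm (f x * g x) \<le> A * B" for x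
    by (intro order_trans[OF norm_mult_ineq] mult_mono) (auto intro: order_trans[OF norm_ge_zero])
  then show ?thesis
    unfolding bounded_iff by blast
qed

locale moment_convergence =
  fixes \<sigma> :: "nat \<Rightarrow> real measure" and \<sigma>' :: "real measure"
  assumes finite: "\<And>n. finite_borel_measure (\<sigma> n)" "finite_borel_measure \<sigma>'"
    and moments: "\<And>k. (\<lambda>n. moment (\<sigma> n) k) \<longlonglongrightarrow> moment \<sigma>' k"
begin

text \<open>Multiplication by a polynomial preserves this class, which is seen by induction on the polynomial:
  because all powers of \<open>circle_map\<close> are included, a linear function of a point of the circle acts by
  shifts of \<open>k\<close>, and a product of polynomials by multiplying twice. Convergence of \<open>\<integral> h\<close> alone would
  not be inductive.\<close>

definition stable :: "(real \<Rightarrow> complex) \<Rightarrow> bool" where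
  "stable h \<longleftrightarrow> continuous_on UNIV h \<and> bounded (range h) \<and>
     (\<forall>k. (\<lambda>n. LINT x|\<sigma> n. h x * circle_map x powi k) \<longlonglongrightarrow> (LINT x|\<sigma>'. h x * circle_map x powi k))"

lemma bounded_circle_map_powi: "bounded (range (\<lambda>x. circle_map x powi k))"
  unfolding bounded_iff by (auto simp: norm_circle_map_powi)

lemma integrable_stable:
  assumes "stable h" "finite_borel_measure \<mu>"
  shows "integrable \<mu> (\<lambda>x. h x * circle_map x powi k)"
  using assms(1) unfolding stable_def
  by (intro finite_borel_measure.integrable_bounded_continuous[OF assms(2)] continuous_on_mult
      continuous_circle_map_powi bounded_range_mult bounded_circle_map_powi) auto

lemma stable_add:
  assumes "stable g" "stable h"
  shows "stable (\<lambda>x. g x + h x)"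
proof -
  have "(LINT x|\<mu>. (g x + h x) * circle_map x powi k) =
      (LINT x|\<mu>. g x * circle_map x powi k) + (LINT x|\<mu>. h x * circle_map x powi k)"
    if "finite_borel_measure \<mu>" for \<mu> k
    using integrable_stable[OF assms(1) that] integrable_stable[OF assms(2) that]
    by (simp add: distrib_right)
  then show ?thesis
    using assms finite unfolding stable_def
    by (auto intro!: continuous_on_add bounded_plus_comp tendsto_add)
qed

lemma stable_scale:
  assumes "stable h"
  shows "stable (\<lambda>x. c * h x)"
proof -
  have "bounded (range (\<lambda>x. c))" by (auto simp: bounded_iff)
  then show ?thesis
    using assms unfolding stable_def
    by (auto intro!: continuous_intros bounded_range_mult tendsto_intros simp: mult.assoc)
qed

lemma stable_shift:
  assumes "stable h"
  shows "stable (\<lambda>x. h x * circle_map x powi j)"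
  unfolding stable_def
proof (intro conjI allI)
  show "continuous_on UNIV (\<lambda>x. h x * circle_map x powi j)"
    using assms unfolding stable_def by (intro continuous_on_mult continuous_circle_map_powi) auto
  show "bounded (range (\<lambda>x. h x * circle_map x powi j))"
    using assms unfolding stable_def by (intro bounded_range_mult bounded_circle_map_powi) auto
  show "(\<lambda>n. LINT x|\<sigma> n. h x * circle_map x powi j * circle_map x powi k)
      \<longlonglongrightarrow> (LINT x|\<sigma>'. h x * circle_map x powi j * circle_map x powi k)" for k
    using assms by (simp add: stable_def mult.assoc power_int_add[symmetric])
qed

lemma stable_polynomial:
  assumes "real_polynomial_function p"
  shows "stable h \<Longrightarrow> stable (\<lambda>x. of_real (p (circle_map x)) * h x)"
  using assms
proof (induction p arbitrary: h)
  case (linear p)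
  interpret p: bounded_linear p by (rule linear)
  \<comment> \<open>A real linear function of \<open>w\<close> is a combination of \<open>w\<close> and \<open>cnj w\<close>, and \<open>cnj w = inverse w\<close> on the circle.\<close>
  define \<alpha> \<beta> where "\<alpha> = (of_real (p 1) - \<i> * of_real (p \<i>)) / 2" and "\<beta> = (of_real (p 1) + \<i> * of_real (p \<i>)) / 2"
  have "of_real (p w) = \<alpha> * w + \<beta> * cnj w" for w
  proof -
    have "p w = p (Re w *\<^sub>R 1 + Im w *\<^sub>R \<i>)"
      by (intro arg_cong[of _ _ p]) (simp add: complex_eq_iff)
    also have "\<dots> = Re w * p 1 + Im w * p \<i>"
      by (simp only: p.add p.scaleR real_scaleR_def)
    finally show ?thesis
      by (simp add: \<alpha>_def \<beta>_def complex_eq_iff field_simps)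
  qed
  then have "of_real (p (circle_map x)) * h x =
      \<alpha> * (h x * circle_map x powi 1) + \<beta> * (h x * circle_map x powi (- 1))" for x
    by (simp add: cnj_circle_map power_int_minus algebra_simps)
  then show ?case
    using linear(2) by (simp only:) (intro stable_add stable_scale stable_shift)
next
  case (const c)
  then show ?case by (intro stable_scale)
next
  case (add p q)
  then show ?case
    by (simp add: distrib_right stable_add)
next
  case (mult p q)
  then show ?case
    by (simp add: mult.assoc)
qed

lemma total_mass: "(\<lambda>n. measure (\<sigma> n) UNIV) \<longlonglongrightarrow> measure \<sigma>' UNIV"
  using moments[of 0] finite by (simp add: moment_0 tendsto_of_real_iff)

lemma polynomial_integral_tendsto:
  assumes "real_polynomial_function p"
  shows "(\<lambda>n. LINT x|\<sigma> n. p (circle_map x)) \<longlonglongrightarrow> (LINT x|\<sigma>'. p (circle_map x))"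
proof -
  have "stable (\<lambda>x. 1)"
    using moments by (auto simp: stable_def moment_def bounded_iff)
  from stable_polynomial[OF assms this]
  have "(\<lambda>n. LINT x|\<sigma> n. complex_of_real (p (circle_map x)) * 1 * circle_map x powi 0)
      \<longlonglongrightarrow> (LINT x|\<sigma>'. complex_of_real (p (circle_map x)) * 1 * circle_map x powi 0)"
    unfolding stable_def by blast
  then show ?thesis
    by (simp add: tendsto_of_real_iff)
qed

lemma circle_integral_tendsto:
  fixes g :: "complex \<Rightarrow> real"
  assumes g: "continuous_on (sphere 0 1) g"
  shows "(\<lambda>n. LINT x|\<sigma> n. g (circle_map x)) \<longlonglongrightarrow> (LINT x|\<sigma>'. g (circle_map x))"
proof (rule tendsto_by_approximation)
  fix e :: real assume e: "e > 0"
  define \<epsilon> where "\<epsilon> = e / (1 + measure \<sigma>' UNIV)"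
  have \<epsilon>: "\<epsilon> > 0" "\<epsilon> * measure \<sigma>' UNIV < e"
    using e by (simp_all add: \<epsilon>_def add_pos_nonneg field_simps)
  obtain p where p: "real_polynomial_function p" "\<And>w. w \<in> sphere 0 1 \<Longrightarrow> \<bar>g w - p w\<bar> < \<epsilon>"
    using Stone_Weierstrass_real_polynomial_function[OF compact_sphere g \<epsilon>(1)] by blast
  have circle: "circle_map ` UNIV \<subseteq> sphere 0 1" by auto
  have cont_p: "continuous_on (sphere 0 1) p"
    using p(1) by (simp add: continuous_on_polymonial_function real_polynomial_function_eq)
  have close: "\<bar>(LINT x|\<mu>. g (circle_map x)) - (LINT x|\<mu>. p (circle_map x))\<bar> \<le> \<epsilon> * measure \<mu> UNIV"
    if \<mu>: "finite_borel_measure \<mu>" for \<mu>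
  proof -
    interpret finite_borel_measure \<mu> by fact
    have int: "integrable \<mu> (\<lambda>x. h (circle_map x))" if "continuous_on (sphere 0 1) h" for h :: "complex \<Rightarrow> real"
    proof (rule integrable_bounded_continuous)
      show "continuous_on UNIV (\<lambda>x. h (circle_map x))"
        by (rule continuous_on_compose2[OF that continuous_circle_map circle])
      have "bounded (h ` sphere 0 1)"
        by (intro compact_imp_bounded compact_continuous_image that) auto
      then show "bounded (range (\<lambda>x. h (circle_map x)))"
        by (rule bounded_subset) auto
    qed
    have "\<bar>(LINT x|\<mu>. g (circle_map x)) - (LINT x|\<mu>. p (circle_map x))\<bar> =
        \<bar>LINT x|\<mu>. g (circle_map x) - p (circle_map x)\<bar>"
      using int[OF g] int[OF cont_p] by simp
    also have "\<dots> \<le> (LINT x|\<mu>. \<bar>g (circle_map x) - p (circle_map x)\<bar>)"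
      by (rule integral_abs_bound)
    also have "\<dots> \<le> (LINT x|\<mu>. \<epsilon>)"
      using int[OF g] int[OF cont_p] p(2) by (intro integral_mono) (auto intro: less_imp_le)
    also have "\<dots> = \<epsilon> * measure \<mu> UNIV"
      using finite_borel_measure_space[OF \<mu>] by simp
    finally show ?thesis .
  qed
  show "\<exists>b b' d d'. b \<longlonglongrightarrow> b' \<and> d \<longlonglongrightarrow> d' \<and>
     (\<forall>n. \<bar>(LINT x|\<sigma> n. g (circle_map x)) - b n\<bar> \<le> d n) \<and>
     \<bar>(LINT x|\<sigma>'. g (circle_map x)) - b'\<bar> \<le> d' \<and> d' < e"
    using polynomial_integral_tendsto[OF p(1)] tendsto_mult_left[OF total_mass, of \<epsilon>] close finite \<epsilon>(2)
    by blast
qed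

text \<open>Written on the circle, \<open>1 / (1 + x\<^sup>2)\<close> is \<open>\<bar>w - 1\<bar>\<^sup>2 / 4\<close>. It vanishes at the point that stands for
  infinity, so \<open>f x / (1 + x\<^sup>2)\<close> extends continuously to the whole circle for every bounded
  continuous \<open>f\<close>.\<close>

lemma damped_integral_tendsto:
  fixes f :: "real \<Rightarrow> real"
  assumes f: "continuous_on UNIV f" "bounded (range f)"
  shows "(\<lambda>n. LINT x|\<sigma> n. f x / (1 + x\<^sup>2)) \<longlonglongrightarrow> (LINT x|\<sigma>'. f x / (1 + x\<^sup>2))"
proof -
  \<comment> \<open>The inverse of \<open>circle_map\<close> is \<open>w \<mapsto> \<i> (w + 1) / (w - 1)\<close>. At \<open>w = 1\<close> the second factor makes the value \<open>0\<close>.\<close>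
  define g where "g w = f (Re (\<i> * (w + 1) / (w - 1))) * (norm (w - 1))\<^sup>2 / 4" for w
  obtain B where B: "\<And>x. \<bar>f x\<bar> \<le> B"
    using f(2) by (auto simp: bounded_iff)
  have "isCont g w" for w
  proof (cases "w = 1")
    case True
    have lim: "(\<lambda>w. B * (norm (w - 1 :: complex))\<^sup>2 / 4) \<midarrow>1\<rightarrow> 0"
      by (auto intro!: tendsto_eq_intros)
    have "g \<midarrow>1\<rightarrow> 0"
      using B by (intro Lim_null_comparison[OF always_eventually lim])
        (auto simp: g_def abs_mult intro!: mult_right_mono)
    then show ?thesis
      by (simp add: isCont_def True g_def)
  next
    case False
    have "continuous_on (- {1}) g"
      unfolding g_def by (intro continuous_intros continuous_on_compose2[OF f(1)]) auto
    then show ?thesis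
      using False by (simp add: continuous_on_eq_continuous_at open_Compl)
  qed
  then have "continuous_on (sphere 0 1) g"
    by (simp add: continuous_at_imp_continuous_on)
  moreover have "g (circle_map x) = f x / (1 + x\<^sup>2)" for x
  proof -
    note nz = circle_map_denominator[of x]
    have minus: "circle_map x - 1 = 2 * \<i> / (of_real x - \<i>)"
      using nz by (simp add: circle_map_def field_simps)
    have plus: "circle_map x + 1 = 2 * of_real x / (of_real x - \<i>)"
      using nz by (simp add: circle_map_def field_simps)
    have "\<i> * (circle_map x + 1) / (circle_map x - 1) = of_real x"
      unfolding minus plus using nz by simp
    moreover have "(norm (circle_map x - 1))\<^sup>2 = 4 / (1 + x\<^sup>2)"
      unfolding minus by (simp add: norm_divide power_divide cmod_power2 norm_mult add.commute)
    moreover have "f x * (4 / c) / 4 = f x / c" for c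
      by simp
    ultimately show ?thesis
      by (simp only: g_def Re_complex_of_real)
  qed
  ultimately show ?thesis
    using circle_integral_tendsto[of g] by simp
qed

end

definition cutoff :: "real \<Rightarrow> real \<Rightarrow> real" where
  "cutoff R x = max 0 (min 1 (R + 1 - \<bar>x\<bar>))"

lemma cutoff_bounds: "0 \<le> cutoff R x" "cutoff R x \<le> 1"
  by (auto simp: cutoff_def)

lemma cutoff_eq_1: "\<bar>x\<bar> \<le> R \<Longrightarrow> cutoff R x = 1"
  by (auto simp: cutoff_def)

lemma cutoff_eq_0: "R + 1 \<le> \<bar>x\<bar> \<Longrightarrow> cutoff R x = 0"
  by (auto simp: cutoff_def)

lemma continuous_cutoff: "continuous_on UNIV (cutoff R)"
  unfolding cutoff_def by (intro continuous_intros)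

lemma bounded_cutoff: "bounded (range (cutoff R))"
  using cutoff_bounds unfolding bounded_iff by (intro exI[of _ 1]) auto

lemma integral_outside_cutoff_small:
  assumes \<sigma>: "finite_borel_measure \<sigma>" and e: "e > 0"
  obtains R where "R \<ge> 0" "(LINT x|\<sigma>. 1 - cutoff R x) < e"
proof -
  interpret finite_borel_measure \<sigma> by fact
  have [measurable]: "cutoff R \<in> borel_measurable \<sigma>" for R
    using borel_measurable_continuous_onI[OF continuous_cutoff] measurable_cong_sets[OF M_is_borel refl]
    by blast
  have "(\<lambda>n. LINT x|\<sigma>. 1 - cutoff (real n) x) \<longlonglongrightarrow> (LINT x|\<sigma>. 0)"
  proof (rule integral_dominated_convergence[where w = "\<lambda>_. 1"])
    show "AE x in \<sigma>. (\<lambda>n. 1 - cutoff (real n) x) \<longlonglongrightarrow> 0"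
    proof (rule AE_I2)
      fix x :: real
      obtain N where N: "\<bar>x\<bar> \<le> real N" using real_arch_simple by blast
      have "\<forall>\<^sub>F n in sequentially. 1 - cutoff (real n) x = 0"
        using eventually_ge_at_top[of N]
      proof eventually_elim
        case (elim n)
        then have "\<bar>x\<bar> \<le> real n" using N by linarith
        then show ?case by (simp add: cutoff_eq_1)
      qed
      then show "(\<lambda>n. 1 - cutoff (real n) x) \<longlonglongrightarrow> 0"
        by (rule tendsto_eventually)
    qed
    show "AE x in \<sigma>. norm (1 - cutoff (real n) x) \<le> 1" for n
    proof (rule AE_I2)
      fix x show "norm (1 - cutoff (real n) x) \<le> 1"
        using cutoff_bounds[of "real n" x] by simp
    qed
  qed auto
  then have "\<forall>\<^sub>F n in sequentially. (LINT x|\<sigma>. 1 - cutoff (real n) x) < e"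
    using e by (intro order_tendstoD(2)) auto
  then obtain n where "(LINT x|\<sigma>. 1 - cutoff (real n) x) < e"
    by (auto simp: eventually_sequentially)
  then show ?thesis
    by (intro that[of "real n"]) auto
qed

context moment_convergence
begin

text \<open>On the support of the cutoff the factor \<open>1 + x\<^sup>2\<close> is bounded and can be absorbed into \<open>f\<close>.\<close>

lemma cutoff_integral_tendsto:
  fixes f :: "real \<Rightarrow> real"
  assumes f: "continuous_on UNIV f" "bounded (range f)"
  shows "(\<lambda>n. LINT x|\<sigma> n. f x * cutoff R x) \<longlonglongrightarrow> (LINT x|\<sigma>'. f x * cutoff R x)"
proof -
  let ?h = "\<lambda>x. f x * (cutoff R x * (1 + x\<^sup>2))"
  have "norm (cutoff R x * (1 + x\<^sup>2)) \<le> 1 + (R + 1)\<^sup>2" for x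
  proof (cases "\<bar>x\<bar> \<le> R + 1")
    case True
    then have "x\<^sup>2 \<le> (R + 1)\<^sup>2"
      using power_mono[of "\<bar>x\<bar>" "R + 1" 2] by simp
    then have "cutoff R x * (1 + x\<^sup>2) \<le> 1 * (1 + (R + 1)\<^sup>2)"
      by (intro mult_mono cutoff_bounds) auto
    then show ?thesis
      using cutoff_bounds(1)[of R x] by (simp add: abs_mult)
  qed (simp add: cutoff_eq_0)
  then have "bounded (range (\<lambda>x. cutoff R x * (1 + x\<^sup>2)))"
    unfolding bounded_iff by blast
  then have "bounded (range ?h)"
    by (rule bounded_range_mult[OF f(2)])
  moreover have "continuous_on UNIV ?h"
    by (intro continuous_intros f continuous_on_subset[OF continuous_cutoff]) auto
  ultimately have "(\<lambda>n. LINT x|\<sigma> n. ?h x / (1 + x\<^sup>2)) \<longlonglongrightarrow> (LINT x|\<sigma>'. ?h x / (1 + x\<^sup>2))"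
    by (intro damped_integral_tendsto)
  moreover have "?h x / (1 + x\<^sup>2) = f x * cutoff R x" for x
    by (simp add: add_nonneg_eq_0_iff)
  ultimately show ?thesis by simp
qed

text \<open>Tightness: the mass outside the cutoff is the total mass minus an integral of a compactly supported
  function, and both converge to the values for \<open>\<sigma>'\<close>.\<close>

lemma weak_convergence: "weakly_converges_on UNIV \<sigma> \<sigma>'"
  unfolding weakly_converges_on_def
proof (intro allI impI, elim conjE)
  fix f :: "real \<Rightarrow> real"
  assume f: "continuous_on UNIV f" "bounded (range f)"
  obtain B where B: "\<And>x. \<bar>f x\<bar> \<le> B"
    using f(2) by (auto simp: bounded_iff)
  then have "B \<ge> 0" by (meson abs_ge_zero order_trans)
  show "(\<lambda>n. integral\<^sup>L (\<sigma> n) f) \<longlonglongrightarrow> integral\<^sup>L \<sigma>' f"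
  proof (rule tendsto_by_approximation)
    fix e :: real assume e: "e > 0"
    then have "e / (1 + B) > 0"
      using \<open>B \<ge> 0\<close> by simp
    then obtain R where R: "(LINT x|\<sigma>'. 1 - cutoff R x) < e / (1 + B)"
      by (rule integral_outside_cutoff_small[OF finite(2)])
    have small: "B * (LINT x|\<sigma>'. 1 - cutoff R x) < e"
    proof -
      have "0 \<le> (LINT x|\<sigma>'. 1 - cutoff R x)"
        using cutoff_bounds by (intro Bochner_Integration.integral_nonneg) auto
      then have "B * (LINT x|\<sigma>'. 1 - cutoff R x) \<le> (1 + B) * (LINT x|\<sigma>'. 1 - cutoff R x)"
        by (intro mult_right_mono) auto
      also have "\<dots> < e"
        using R \<open>B \<ge> 0\<close> by (simp add: field_simps)
      finally show ?thesis .
    qed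
    have close: "\<bar>integral\<^sup>L \<mu> f - (LINT x|\<mu>. f x * cutoff R x)\<bar> \<le> B * (LINT x|\<mu>. 1 - cutoff R x)"
      if \<mu>: "finite_borel_measure \<mu>" for \<mu>
    proof -
      interpret finite_borel_measure \<mu> by fact
      have int: "integrable \<mu> f" "integrable \<mu> (\<lambda>x. f x * cutoff R x)" "integrable \<mu> (\<lambda>x. 1 - cutoff R x)"
        by (intro integrable_bounded_continuous f continuous_on_mult continuous_cutoff bounded_range_mult bounded_cutoff
            Bochner_Integration.integrable_diff integrable_const)+
      have "\<bar>integral\<^sup>L \<mu> f - (LINT x|\<mu>. f x * cutoff R x)\<bar> = \<bar>LINT x|\<mu>. f x - f x * cutoff R x\<bar>"
        using int by simp
      also have "\<dots> \<le> (LINT x|\<mu>. \<bar>f x - f x * cutoff R x\<bar>)"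
        by (rule integral_abs_bound)
      also have "\<dots> \<le> (LINT x|\<mu>. B * (1 - cutoff R x))"
      proof (rule integral_mono)
        show "integrable \<mu> (\<lambda>x. \<bar>f x - f x * cutoff R x\<bar>)"
          using int by (intro integrable_abs Bochner_Integration.integrable_diff)
        show "integrable \<mu> (\<lambda>x. B * (1 - cutoff R x))"
          using int by (intro integrable_mult_right)
        fix x
        have "\<bar>f x - f x * cutoff R x\<bar> = \<bar>f x\<bar> * (1 - cutoff R x)"
          using cutoff_bounds(2)[of R x] by (metis abs_mult abs_of_nonneg diff_ge_0_iff_ge mult.right_neutral right_diff_distrib)
        then show "\<bar>f x - f x * cutoff R x\<bar> \<le> B * (1 - cutoff R x)"
          using B[of x] cutoff_bounds(2)[of R x] by (simp add: mult_right_mono)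
      qed
      finally show ?thesis by simp
    qed
    have outside: "(\<lambda>n. B * (LINT x|\<sigma> n. 1 - cutoff R x)) \<longlonglongrightarrow> B * (LINT x|\<sigma>'. 1 - cutoff R x)"
    proof -
      have "(LINT x|\<mu>. 1 - cutoff R x) = measure \<mu> UNIV - (LINT x|\<mu>. 1 * cutoff R x)"
        if \<mu>: "finite_borel_measure \<mu>" for \<mu>
      proof -
        interpret finite_borel_measure \<mu> by fact
        have "integrable \<mu> (cutoff R)"
          by (intro integrable_bounded_continuous continuous_cutoff bounded_cutoff)
        then show ?thesis
          by (simp add: finite_borel_measure_space[OF \<mu>])
      qed
      then show ?thesis
        using finite by (auto intro!: tendsto_intros total_mass cutoff_integral_tendsto[of "\<lambda>_. 1", simplified])
    qed
    show "\<exists>b b' d d'. b \<longlonglongrightarrow> b' \<and> d \<longlonglongrightarrow> d' \<and>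
       (\<forall>n. \<bar>integral\<^sup>L (\<sigma> n) f - b n\<bar> \<le> d n) \<and> \<bar>integral\<^sup>L \<sigma>' f - b'\<bar> \<le> d' \<and> d' < e"
      using cutoff_integral_tendsto[OF f, of R] outside close finite small by blast
  qed
qed

end

text \<open>Mass that escapes to infinity would leave a multiple of \<open>- z\<close>, the limit of the kernel as \<open>x\<close> tends to
  infinity. The assumed form of the limit has no such term, which yields tightness.\<close>

theorem nevanlinna_continuity:
  fixes \<gamma> :: "nat \<Rightarrow> real"
  assumes \<sigma>: "\<And>n. finite_borel_measure (\<sigma> n)" "finite_borel_measure \<sigma>'"
    and A: "A \<subseteq> upper_half_plane" "z0 \<in> upper_half_plane" "z0 islimpt A"
    and lim: "\<And>z. z \<in> A \<Longrightarrow> (\<lambda>n. of_real (\<gamma> n) + nevanlinna_transform (\<sigma> n) z)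
                \<longlonglongrightarrow> of_real \<gamma>' + nevanlinna_transform \<sigma>' z"
  shows "\<gamma> \<longlonglongrightarrow> \<gamma>'" "weakly_converges_on UNIV \<sigma> \<sigma>'"
proof -
  show "\<gamma> \<longlonglongrightarrow> \<gamma>'"
    by (rule moments_tendsto(1)[OF \<sigma> A lim])
  interpret moment_convergence \<sigma> \<sigma>'
    by (rule moment_convergence.intro[OF \<sigma> moments_tendsto(2)[OF \<sigma> A lim]])
  show "weakly_converges_on UNIV \<sigma> \<sigma>'"
    by (rule weak_convergence)
qed

section \<open>Families of measures that increase in time\<close>

lemma integral_le_of_measure_le:
  fixes f :: "real \<Rightarrow> real"
  assumes \<mu>: "finite_borel_measure \<mu>" and \<nu>: "finite_borel_measure \<nu>"
    and le: "\<And>B. B \<in> sets borel \<Longrightarrow> measure \<mu> B \<le> measure \<nu> B"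
    and f: "continuous_on UNIV f" "bounded (range f)" "\<And>x. 0 \<le> f x"
  shows "integral\<^sup>L \<mu> f \<le> integral\<^sup>L \<nu> f"
proof -
  interpret \<mu>: finite_borel_measure \<mu> by fact
  interpret \<nu>: finite_borel_measure \<nu> by fact
  have sets: "sets \<mu> = sets \<nu>"
    by (simp add: \<mu>.M_is_borel \<nu>.M_is_borel)
  have "emeasure \<mu> B \<le> emeasure \<nu> B" for B
  proof (cases "B \<in> sets borel")
    case True
    then show ?thesis
      using le by (simp add: \<mu>.emeasure_eq_measure \<nu>.emeasure_eq_measure ennreal_leI)
  qed (simp add: emeasure_notin_sets \<mu>.M_is_borel)
  then have "\<mu> \<le> \<nu>"
    using sets by (simp add: le_measure le_fun_def)
  then have "(\<integral>\<^sup>+x. f x \<partial>\<mu>) \<le> (\<integral>\<^sup>+x. f x \<partial>\<nu>)"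
    by (intro nn_integral_mono_measure sets) auto
  then have "ennreal (integral\<^sup>L \<mu> f) \<le> ennreal (integral\<^sup>L \<nu> f)"
    using f \<mu>.integrable_bounded_continuous[OF f(1,2)] \<nu>.integrable_bounded_continuous[OF f(1,2)]
    by (simp add: nn_integral_eq_integral)
  then show ?thesis
    using f by (simp add: ennreal_le_iff)
qed

lemma integral_shift:
  fixes f :: "real \<Rightarrow> real"
  assumes \<mu>: "finite_borel_measure \<mu>" and f: "continuous_on UNIV f" "bounded (range f)"
  shows "(LINT x|\<mu>. C + f x) = C * measure \<mu> UNIV + integral\<^sup>L \<mu> f"
    "(LINT x|\<mu>. C - f x) = C * measure \<mu> UNIV - integral\<^sup>L \<mu> f"
proof -
  interpret finite_borel_measure \<mu> by fact
  show "(LINT x|\<mu>. C + f x) = C * measure \<mu> UNIV + integral\<^sup>L \<mu> f"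
    "(LINT x|\<mu>. C - f x) = C * measure \<mu> UNIV - integral\<^sup>L \<mu> f"
    using integrable_bounded_continuous[OF f] finite_borel_measure_space[OF \<mu>] by simp_all
qed

text \<open>Monotonicity of the integral, applied to the nonnegative functions \<open>C + f\<close> and \<open>C - f\<close>.\<close>

lemma integral_increment_le:
  fixes f :: "real \<Rightarrow> real"
  assumes \<mu>: "finite_borel_measure \<mu>" and \<nu>: "finite_borel_measure \<nu>"
    and le: "\<And>B. B \<in> sets borel \<Longrightarrow> measure \<mu> B \<le> measure \<nu> B"
    and f: "continuous_on UNIV f" "\<And>x. \<bar>f x\<bar> \<le> C"
  shows "\<bar>integral\<^sup>L \<nu> f - integral\<^sup>L \<mu> f\<bar> \<le> C * (measure \<nu> UNIV - measure \<mu> UNIV)"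
proof -
  have bdd: "bounded (range f)" "bounded (range (\<lambda>x. C + f x))" "bounded (range (\<lambda>x. C - f x))"
  proof -
    show *: "bounded (range f)" using f(2) by (auto simp: bounded_iff)
    have "norm (C + f x) \<le> 2 * C" "norm (C - f x) \<le> 2 * C" for x
      using f(2)[of x] by (auto simp: abs_le_iff)
    then show "bounded (range (\<lambda>x. C + f x))" "bounded (range (\<lambda>x. C - f x))"
      unfolding bounded_iff by blast+
  qed
  have nonneg: "0 \<le> C + f x" "0 \<le> C - f x" for x
    using f(2)[of x] by (auto simp: abs_le_iff)
  have "(LINT x|\<mu>. C + f x) \<le> (LINT x|\<nu>. C + f x)" "(LINT x|\<mu>. C - f x) \<le> (LINT x|\<nu>. C - f x)"
    using f(1) bdd nonneg by (intro integral_le_of_measure_le \<mu> \<nu> le continuous_intros; simp)+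
  then show ?thesis
    unfolding integral_shift[OF \<mu> f(1) bdd(1)] integral_shift[OF \<nu> f(1) bdd(1)]
    by (simp add: abs_le_iff algebra_simps)
qed

lemma time_intervalD:
  assumes "time_interval I"
  shows "0 \<in> I" "t \<in> I \<Longrightarrow> 0 \<le> t" "a \<in> I \<Longrightarrow> b \<in> I \<Longrightarrow> a \<le> c \<Longrightarrow> c \<le> b \<Longrightarrow> c \<in> I"
  using assms by (auto simp: time_interval_def)

lemma generating_familyD:
  assumes "generating_family I \<gamma> \<eta>"
  shows "continuous_on I \<gamma>" "t \<in> I \<Longrightarrow> finite_borel_measure (\<eta> t)" "\<eta> 0 = null_measure borel"
    "B \<in> sets borel \<Longrightarrow> s \<in> I \<Longrightarrow> t \<in> I \<Longrightarrow> s \<le> t \<Longrightarrow> measure (\<eta> s) B \<le> measure (\<eta> t) B"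
    "B \<in> sets borel \<Longrightarrow> continuous_on I (\<lambda>t. measure (\<eta> t) B)"
  using assms by (auto simp: generating_family_def mono_on_def)

text \<open>The increments of \<open>\<integral> f d\<eta>\<^sub>t\<close> are dominated by those of the total mass \<open>\<eta>\<^sub>t(UNIV)\<close>, which is
  continuous in \<open>t\<close>.\<close>

lemma generating_family_weakly_continuous:
  assumes gen: "generating_family I \<gamma> \<eta>"
  shows "weakly_continuous_on I \<eta>"
  unfolding weakly_continuous_on_def
proof (intro allI impI, elim conjE)
  fix f :: "real \<Rightarrow> real"
  assume f: "continuous_on UNIV f" "bounded (range f)"
  obtain C where C: "\<And>x. \<bar>f x\<bar> \<le> C"
    using f(2) by (auto simp: bounded_iff)
  then have "C \<ge> 0" by (meson abs_ge_zero order_trans)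
  have le: "dist (integral\<^sup>L (\<eta> s) f) (integral\<^sup>L (\<eta> t) f) \<le> dist (C * measure (\<eta> s) UNIV) (C * measure (\<eta> t) UNIV)"
    if "s \<in> I" "t \<in> I" "s \<le> t" for s t
  proof -
    have "\<bar>integral\<^sup>L (\<eta> t) f - integral\<^sup>L (\<eta> s) f\<bar> \<le> C * (measure (\<eta> t) UNIV - measure (\<eta> s) UNIV)"
      using that by (intro integral_increment_le f C generating_familyD[OF gen])
    also have "\<dots> \<le> \<bar>C * measure (\<eta> t) UNIV - C * measure (\<eta> s) UNIV\<bar>"
      by (simp add: right_diff_distrib)
    finally show ?thesis
      by (simp add: dist_real_def abs_minus_commute)
  qed
  have le': "dist (integral\<^sup>L (\<eta> s) f) (integral\<^sup>L (\<eta> t) f) \<le> dist (C * measure (\<eta> s) UNIV) (C * measure (\<eta> t) UNIV)"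
    if "s \<in> I" "t \<in> I" for s t
    using le[of s t] le[of t s] that by (cases "s \<le> t") (auto simp: dist_commute)
  have cont: "continuous_on I (\<lambda>t. C * measure (\<eta> t) UNIV)"
    using gen by (intro continuous_intros generating_familyD(5)) auto
  show "continuous_on I (\<lambda>t. integral\<^sup>L (\<eta> t) f)"
    unfolding continuous_on_def
  proof
    fix t assume t: "t \<in> I"
    have "((\<lambda>s. C * measure (\<eta> s) UNIV) \<longlongrightarrow> C * measure (\<eta> t) UNIV) (at t within I)"
      using cont t by (simp add: continuous_on_def)
    then show "((\<lambda>s. integral\<^sup>L (\<eta> s) f) \<longlongrightarrow> integral\<^sup>L (\<eta> t) f) (at t within I)"
      by (rule metric_tendsto_imp_tendsto) (use le' t in \<open>auto simp: eventually_at_filter\<close>)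
  qed
qed

text \<open>The argument of Polya's theorem: \<open>F n (x n)\<close> lies between the values of \<open>F n\<close> at two fixed points
  close to the limit of \<open>x\<close>. If that limit is an endpoint of \<open>I\<close>, it serves itself as the bounding
  point on its side.\<close>

lemma monotone_pointwise_imp_locally_uniform:
  fixes F :: "nat \<Rightarrow> real \<Rightarrow> real"
  assumes I: "time_interval I"
    and mono: "\<And>n. mono_on I (F n)" and g: "continuous_on I g"
    and lim: "\<And>t. t \<in> I \<Longrightarrow> (\<lambda>n. F n t) \<longlonglongrightarrow> g t"
  shows "locally_uniform_limit I F g"
proof (rule sequences_imp_locally_uniform_limit[OF g])
  fix r :: "nat \<Rightarrow> nat" and x :: "nat \<Rightarrow> real" and l
  assume r: "strict_mono r" and x: "\<And>k. x k \<in> I" "x \<longlonglongrightarrow> l" and l: "l \<in> I"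
  have lim_r: "(\<lambda>k. F (r k) t) \<longlonglongrightarrow> g t" if "t \<in> I" for t
    using LIMSEQ_subseq_LIMSEQ[OF lim[OF that] r] by (simp add: o_def)
  have modulus: "\<exists>\<delta>>0. \<forall>s\<in>I. \<bar>s - l\<bar> < \<delta> \<longrightarrow> \<bar>g s - g l\<bar> < e" if "e > 0" for e
    using g l that by (auto simp: continuous_on_iff dist_real_def)
  show "(\<lambda>k. F (r k) (x k)) \<longlonglongrightarrow> g l"
  proof (rule order_tendstoI)
    fix y assume y: "g l < y"
    have "\<exists>b\<in>I. g b < y \<and> (\<forall>\<^sub>F k in sequentially. x k \<le> b)"
    proof (cases "\<exists>b\<in>I. l < b")
      case True
      then obtain b where b: "b \<in> I" "l < b" by auto
      obtain \<delta> where \<delta>: "\<delta> > 0" "\<And>s. s \<in> I \<Longrightarrow> \<bar>s - l\<bar> < \<delta> \<Longrightarrow> \<bar>g s - g l\<bar> < y - g l"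
        using modulus[of "y - g l"] y by auto
      define c where "c = min b (l + \<delta> / 2)"
      have c: "c \<in> I" "l < c" "\<bar>c - l\<bar> < \<delta>"
        using time_intervalD(3)[OF I l b(1), of c] b \<delta>(1) by (auto simp: c_def min_def)
      have "\<forall>\<^sub>F k in sequentially. x k < c"
        using x(2) c(2) by (rule order_tendstoD)
      then show ?thesis
        using c \<delta>(2)[OF c(1,3)] by (intro bexI[of _ c]) (auto elim: eventually_mono)
    next
      case False
      then have "x k \<le> l" for k
        using x(1)[of k] by (meson not_le)
      then show ?thesis
        using l y by (intro bexI[of _ l]) auto
    qed
    then obtain b where b: "b \<in> I" "g b < y" "\<forall>\<^sub>F k in sequentially. x k \<le> b" by auto
    have "\<forall>\<^sub>F k in sequentially. F (r k) b < y"
      using lim_r[OF b(1)] b(2) by (rule order_tendstoD)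
    with b(3) show "\<forall>\<^sub>F k in sequentially. F (r k) (x k) < y"
    proof eventually_elim
      case (elim k)
      then show ?case
        using mono_onD[OF mono x(1)[of k] b(1), of "r k"] by linarith
    qed
  next
    fix y assume y: "y < g l"
    have "\<exists>b\<in>I. y < g b \<and> (\<forall>\<^sub>F k in sequentially. b \<le> x k)"
    proof (cases "\<exists>b\<in>I. b < l")
      case True
      then obtain b where b: "b \<in> I" "b < l" by auto
      obtain \<delta> where \<delta>: "\<delta> > 0" "\<And>s. s \<in> I \<Longrightarrow> \<bar>s - l\<bar> < \<delta> \<Longrightarrow> \<bar>g s - g l\<bar> < g l - y"
        using modulus[of "g l - y"] y by auto
      define c where "c = max b (l - \<delta> / 2)"
      have c: "c \<in> I" "c < l" "\<bar>c - l\<bar> < \<delta>"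
        using time_intervalD(3)[OF I b(1) l, of c] b \<delta>(1) by (auto simp: c_def max_def)
      have "\<forall>\<^sub>F k in sequentially. c < x k"
        using x(2) c(2) by (rule order_tendstoD)
      then show ?thesis
        using c \<delta>(2)[OF c(1,3)] by (intro bexI[of _ c]) (auto elim: eventually_mono)
    next
      case False
      then have "l \<le> x k" for k
        using x(1)[of k] by (meson not_le)
      then show ?thesis
        using l y by (intro bexI[of _ l]) auto
    qed
    then obtain b where b: "b \<in> I" "y < g b" "\<forall>\<^sub>F k in sequentially. b \<le> x k" by auto
    have "\<forall>\<^sub>F k in sequentially. y < F (r k) b"
      using lim_r[OF b(1)] b(2) by (rule order_tendstoD)
    with b(3) show "\<forall>\<^sub>F k in sequentially. y < F (r k) (x k)"
    proof eventually_elim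
      case (elim k)
      then show ?case
        using mono_onD[OF mono b(1) x(1)[of k], of "r k"] by linarith
    qed
  qed
qed

text \<open>A bounded function is the difference of the nonnegative functions \<open>C + f\<close> and \<open>C\<close>, whose integrals are
  nondecreasing in time.\<close>

lemma pointwise_weak_imp_locally_uniform:
  assumes I: "time_interval I"
    and gen: "\<And>n. generating_family I (\<gamma>n n) (\<eta>n n)" "generating_family I \<gamma> \<eta>"
    and lim: "\<And>t. t \<in> I \<Longrightarrow> weakly_converges_on UNIV (\<lambda>n. \<eta>n n t) (\<eta> t)"
  shows "weakly_converges_locally_uniformly I \<eta>n \<eta>"
  unfolding weakly_converges_locally_uniformly_def
proof (intro allI impI, elim conjE)
  fix f :: "real \<Rightarrow> real"
  assume f: "continuous_on UNIV f" "bounded (range f)"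
  obtain C where C: "\<And>x. \<bar>f x\<bar> \<le> C"
    using f(2) by (auto simp: bounded_iff)
  have nonneg_case: "locally_uniform_limit I (\<lambda>n t. integral\<^sup>L (\<eta>n n t) h) (\<lambda>t. integral\<^sup>L (\<eta> t) h)"
    if h: "continuous_on UNIV h" "bounded (range h)" "\<And>x. 0 \<le> h x" for h :: "real \<Rightarrow> real"
  proof (rule monotone_pointwise_imp_locally_uniform[OF I])
    show "mono_on I (\<lambda>t. integral\<^sup>L (\<eta>n n t) h)" for n
      by (intro mono_onI integral_le_of_measure_le h generating_familyD[OF gen(1)])
    show "continuous_on I (\<lambda>t. integral\<^sup>L (\<eta> t) h)"
      using generating_family_weakly_continuous[OF gen(2)] h by (auto simp: weakly_continuous_on_def)
    show "(\<lambda>n. integral\<^sup>L (\<eta>n n t) h) \<longlonglongrightarrow> integral\<^sup>L (\<eta> t) h" if "t \<in> I" for t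
      using lim[OF that] h by (auto simp: weakly_converges_on_def)
  qed
  have "norm (C + f x) \<le> 2 * C" for x
    using C[of x] by (auto simp: abs_le_iff)
  then have "bounded (range (\<lambda>x. C + f x))"
    unfolding bounded_iff by blast
  moreover have "0 \<le> C + f x" for x
    using C[of x] by (auto simp: abs_le_iff)
  ultimately have plus: "locally_uniform_limit I (\<lambda>n t. LINT x|\<eta>n n t. C + f x) (\<lambda>t. LINT x|\<eta> t. C + f x)"
    using f(1) by (intro nonneg_case continuous_intros) auto
  have "0 \<le> C" using C by (meson abs_ge_zero order_trans)
  then have const: "locally_uniform_limit I (\<lambda>n t. LINT x|\<eta>n n t. C) (\<lambda>t. LINT x|\<eta> t. C)"
    by (intro nonneg_case) (auto simp: bounded_iff)
  have split: "integral\<^sup>L \<mu> f = (LINT x|\<mu>. C + f x) - (LINT x|\<mu>. C)" if "finite_borel_measure \<mu>" for \<mu>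
    using integral_shift(1)[OF that f, of C] finite_borel_measure_space[OF that] by simp
  show "locally_uniform_limit I (\<lambda>n t. integral\<^sup>L (\<eta>n n t) f) (\<lambda>t. integral\<^sup>L (\<eta> t) f)"
    unfolding locally_uniform_limit_def
  proof (intro allI impI, elim conjE)
    fix K assume K: "compact K" "K \<subseteq> I"
    have "uniform_limit K (\<lambda>n t. (LINT x|\<eta>n n t. C + f x) - (LINT x|\<eta>n n t. C))
        (\<lambda>t. (LINT x|\<eta> t. C + f x) - (LINT x|\<eta> t. C)) sequentially"
      using plus const K by (intro uniform_limit_minus) (auto simp: locally_uniform_limit_def)
    moreover have "(LINT x|\<eta>n n t. C + f x) - (LINT x|\<eta>n n t. C) = integral\<^sup>L (\<eta>n n t) f"
      "(LINT x|\<eta> t. C + f x) - (LINT x|\<eta> t. C) = integral\<^sup>L (\<eta> t) f" if "t \<in> K" for n t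
      using K(2) that split generating_familyD(2)[OF gen(1)] generating_familyD(2)[OF gen(2)] by auto
    ultimately show "uniform_limit K (\<lambda>n t. integral\<^sup>L (\<eta>n n t) f) (\<lambda>t. integral\<^sup>L (\<eta> t) f) sequentially"
      by (subst (asm) uniform_limit_cong') auto
  qed
qed

lemma locally_uniform_imp_pointwise_weak:
  assumes "weakly_converges_locally_uniformly I \<eta>n \<eta>" "t \<in> I"
  shows "weakly_converges_on UNIV (\<lambda>n. \<eta>n n t) (\<eta> t)"
  unfolding weakly_converges_on_def
proof (intro allI impI)
  fix f :: "real \<Rightarrow> real"
  assume "continuous_on UNIV f \<and> bounded (range f)"
  then have "uniform_limit {t} (\<lambda>n t. integral\<^sup>L (\<eta>n n t) f) (\<lambda>t. integral\<^sup>L (\<eta> t) f) sequentially"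
    using assms by (simp add: weakly_converges_locally_uniformly_def locally_uniform_limit_def del: uniform_limit_singleton)
  then show "(\<lambda>n. integral\<^sup>L (\<eta>n n t) f) \<longlonglongrightarrow> integral\<^sup>L (\<eta> t) f"
    by simp
qed

section \<open>The space-time measure\<close>

locale space_time =
  fixes I :: "real set" and \<gamma> :: "real \<Rightarrow> real" and \<eta> :: "real \<Rightarrow> real measure"
    and H :: "(real \<times> real) measure"
  assumes I: "time_interval I" and gen: "generating_family I \<gamma> \<eta>"
    and H: "is_space_time_measure I \<eta> H"
begin

lemma space_H: "space H = UNIV \<times> I"
  using H sets_eq_imp_space_eq[of H "restrict_space borel (UNIV \<times> I)"]
  by (simp add: is_space_time_measure_def space_restrict_space)

lemma strip_subset: "T \<in> I \<Longrightarrow> UNIV \<times> {0..T} \<subseteq> UNIV \<times> I"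
  using time_intervalD(3)[OF I time_intervalD(1)[OF I]] by auto

lemma borel_subset_in_sets_H:
  assumes "X \<in> sets borel" "X \<subseteq> UNIV \<times> I"
  shows "X \<in> sets H"
proof -
  have "sets H = (\<lambda>A. A \<inter> (UNIV \<times> I)) ` sets borel"
    using H by (simp add: is_space_time_measure_def sets_restrict_space Int_commute)
  then show ?thesis
    using assms by (auto intro!: image_eqI[of _ _ X])
qed

lemma strip_in_sets_H:
  assumes "T \<in> I"
  shows "UNIV \<times> {0..T} \<in> sets H"
  using strip_subset[OF assms] by (intro borel_subset_in_sets_H borel_closed closed_Times) auto

lemma emeasure_H_strip:
  assumes t: "t \<in> I" and B: "B \<in> sets borel"
  shows "emeasure H (B \<times> {0..t}) = emeasure (\<eta> t) B"
proof -
  have "0 \<le> t" using time_intervalD(2)[OF I t] .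
  have prod: "B \<times> J \<in> sets borel" if "J \<in> sets borel" for J :: "real set"
    using B that by (simp add: borel_prod[symmetric])
  have zero_slice: "B \<times> {0} \<in> sets H" "(UNIV :: real set) \<times> {0} \<in> sets H"
    using time_intervalD(1)[OF I] prod[of "{0}"]
    by (auto intro!: borel_subset_in_sets_H borel_closed closed_Times)
  have slab: "B \<times> {0<..t} \<in> sets H"
    using time_intervalD(3)[OF I time_intervalD(1)[OF I] t] by (intro borel_subset_in_sets_H prod) auto
  have "emeasure H (B \<times> {0}) \<le> emeasure H (UNIV \<times> {0})"
    by (intro emeasure_mono zero_slice) auto
  then have "emeasure H (B \<times> {0}) = 0"
    using H by (simp add: is_space_time_measure_def)
  moreover have "emeasure H (B \<times> {0<..t}) = emeasure (\<eta> t) B"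
    using H B t \<open>0 \<le> t\<close> time_intervalD(1)[OF I] generating_familyD(3)[OF gen]
    by (simp add: is_space_time_measure_def)
  moreover have "B \<times> {0..t} = B \<times> {0} \<union> B \<times> {0<..t}"
    using \<open>0 \<le> t\<close> by auto
  moreover have "emeasure H (B \<times> {0} \<union> B \<times> {0<..t}) = emeasure H (B \<times> {0}) + emeasure H (B \<times> {0<..t})"
    by (rule plus_emeasure[symmetric]) (use zero_slice slab in auto)
  ultimately show ?thesis by simp
qed

abbreviation strip :: "real \<Rightarrow> (real \<times> real) measure" where
  "strip T \<equiv> restrict_space H (UNIV \<times> {0..T})"

lemma sets_strip:
  assumes "T \<in> I"
  shows "sets (strip T) = sets (restrict_space borel (UNIV \<times> {0..T}))"
proof -
  have "sets (strip T) = sets (restrict_space (restrict_space borel (UNIV \<times> I)) (UNIV \<times> {0..T}))"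
    using H by (intro sets_restrict_space_cong) (simp add: is_space_time_measure_def)
  also have "\<dots> = sets (restrict_space borel ((UNIV \<times> I) \<inter> (UNIV \<times> {0..T})))"
    by (rule sets_restrict_restrict_space)
  also have "(UNIV \<times> I) \<inter> (UNIV \<times> {0..T}) = (UNIV :: real set) \<times> {0..T}"
    using strip_subset[OF assms] by blast
  finally show ?thesis .
qed

lemma space_strip: "T \<in> I \<Longrightarrow> space (strip T) = UNIV \<times> {0..T}"
  using strip_subset by (auto simp: space_restrict_space space_H)

lemma continuous_measurable_strip:
  fixes f :: "real \<times> real \<Rightarrow> real"
  assumes "T \<in> I" "continuous_on (UNIV \<times> {0..T}) f"
  shows "f \<in> borel_measurable (strip T)"
  using borel_measurable_continuous_on_restrict[OF assms(2)] measurable_cong_sets[OF sets_strip[OF assms(1)] refl]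
  by blast

text \<open>Integrals over a strip of functions of the first coordinate reduce to the measures \<open>\<eta>\<^sub>t\<close>,
  because the slice at time \<open>0\<close> carries no mass and \<open>\<eta>\<^sub>0 = 0\<close>.\<close>

lemma distr_fst_strip:
  assumes t: "t \<in> I"
  shows "distr (strip t) borel fst = \<eta> t"
proof (rule measure_eqI)
  interpret \<eta>: finite_borel_measure "\<eta> t"
    by (rule generating_familyD(2)[OF gen t])
  show "sets (distr (strip t) borel fst) = sets (\<eta> t)"
    by (simp add: \<eta>.M_is_borel)
  have fst: "fst \<in> borel_measurable (strip t)"
    by (intro continuous_measurable_strip t continuous_intros)
  fix B assume "B \<in> sets (distr (strip t) borel fst)"
  then have B: "B \<in> sets borel" by simp
  have "emeasure (distr (strip t) borel fst) B = emeasure (strip t) (fst -` B \<inter> space (strip t))"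
    by (rule emeasure_distr[OF fst B])
  also have "fst -` B \<inter> space (strip t) = B \<times> {0..t}"
    by (auto simp: space_strip[OF t])
  also have "emeasure (strip t) (B \<times> {0..t}) = emeasure H (B \<times> {0..t})"
    using strip_in_sets_H[OF t] by (intro emeasure_restrict_space) auto
  also have "\<dots> = emeasure (\<eta> t) B"
    by (rule emeasure_H_strip[OF t B])
  finally show "emeasure (distr (strip t) borel fst) B = emeasure (\<eta> t) B" .
qed

lemma integral_fst_strip:
  fixes h :: "real \<Rightarrow> real"
  assumes t: "t \<in> I" and h: "continuous_on UNIV h"
  shows "(LINT p|strip t. h (fst p)) = integral\<^sup>L (\<eta> t) h"
proof -
  have fst: "fst \<in> borel_measurable (strip t)"
    by (intro continuous_measurable_strip t continuous_intros)
  show ?thesis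
    unfolding distr_fst_strip[OF t, symmetric]
    by (rule integral_distr[symmetric, OF fst borel_measurable_continuous_onI[OF h]])
qed

lemma integral_fst_until:
  fixes h :: "real \<Rightarrow> real"
  assumes T: "T \<in> I" and t: "0 \<le> t" "t \<le> T" and h: "continuous_on UNIV h"
  shows "(LINT p|strip T. h (fst p) * indicator {..t} (snd p)) = integral\<^sup>L (\<eta> t) h"
proof -
  have tI: "t \<in> I"
    using time_intervalD(3)[OF I time_intervalD(1)[OF I] T t] .
  have "(LINT p|strip T. h (fst p) * indicator {..t} (snd p)) =
      (LINT p|H. indicator (UNIV \<times> {0..T}) p *\<^sub>R (h (fst p) * indicator {..t} (snd p)))"
    using strip_in_sets_H[OF T] by (intro integral_restrict_space) auto
  also have "\<dots> = (LINT p|H. indicator (UNIV \<times> {0..t}) p *\<^sub>R h (fst p))"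
    using t by (intro Bochner_Integration.integral_cong) (auto simp: indicator_def)
  also have "\<dots> = (LINT p|strip t. h (fst p))"
    using strip_in_sets_H[OF tI] by (intro integral_restrict_space[symmetric]) auto
  also have "\<dots> = integral\<^sup>L (\<eta> t) h"
    by (rule integral_fst_strip[OF tI h])
  finally show ?thesis .
qed

lemma finite_measure_strip:
  assumes "T \<in> I"
  shows "finite_measure (strip T)"
proof
  have "emeasure (strip T) (space (strip T)) = emeasure H (UNIV \<times> {0..T})"
    using strip_in_sets_H[OF assms] unfolding space_strip[OF assms] by (intro emeasure_restrict_space) auto
  also have "\<dots> = emeasure (\<eta> T) UNIV"
    by (rule emeasure_H_strip[OF assms]) simp
  finally show "emeasure (strip T) (space (strip T)) \<noteq> \<infinity>"
    using generating_familyD(2)[OF gen assms]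
    by (simp add: finite_borel_measure_def finite_measure.emeasure_finite)
qed

text \<open>The integral of the function that equals \<open>f (x, t\<^sub>j\<^sub>+\<^sub>1)\<close> on the slab \<open>t\<^sub>j < t \<le> t\<^sub>j\<^sub>+\<^sub>1\<close> of an equidistant
  partition of \<open>[0, T]\<close>. The first summand, which is zero for a generating family, belongs to the
  slice at time \<open>0\<close>; with it the slabs cover the whole strip.\<close>

definition step_integral :: "(real \<times> real \<Rightarrow> real) \<Rightarrow> real \<Rightarrow> nat \<Rightarrow> real" where
  "step_integral f T m = (LINT x|\<eta> 0. f (x, 0)) +
     (\<Sum>j<m. (LINT x|\<eta> (T * real (Suc j) / real m). f (x, T * real (Suc j) / real m)) -
             (LINT x|\<eta> (T * real j / real m). f (x, T * real (Suc j) / real m)))"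

text \<open>Inside a compact set the error of the step function is at most \<open>\<epsilon>\<close> by uniform continuity. Outside
  it is at most \<open>2 C\<close>, and there \<open>1 - cutoff R\<close> equals \<open>1\<close>. The resulting bound involves \<open>\<eta>\<^sub>T\<close> only
  through integrals of bounded continuous functions, so it passes to weak limits.\<close>

lemma step_integral_close:
  fixes f :: "real \<times> real \<Rightarrow> real"
  assumes T: "T \<in> I" and m: "m > 0"
    and f: "continuous_on (UNIV \<times> {0..T}) f" "\<And>p. p \<in> UNIV \<times> {0..T} \<Longrightarrow> \<bar>f p\<bar> \<le> C"
    and modulus: "\<And>x s t. \<bar>x\<bar> \<le> R + 1 \<Longrightarrow> s \<in> {0..T} \<Longrightarrow> t \<in> {0..T} \<Longrightarrow> \<bar>s - t\<bar> \<le> T / real m \<Longrightarrow>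
                    \<bar>f (x, s) - f (x, t)\<bar> \<le> \<epsilon>"
    and \<epsilon>: "\<epsilon> \<ge> 0"
  shows "\<bar>(LINT p|strip T. f p) - step_integral f T m\<bar>
    \<le> \<epsilon> * measure (\<eta> T) UNIV + 2 * C * (LINT x|\<eta> T. 1 - cutoff R x)"
proof -
  interpret S: finite_measure "strip T" by (rule finite_measure_strip[OF T])
  interpret \<eta>: finite_borel_measure "\<eta> T" by (rule generating_familyD(2)[OF gen T])
  have T0: "0 \<le> T" by (rule time_intervalD(2)[OF I T])
  define t where "t j = T * real j / real m" for j
  have t: "t 0 = 0" "t m = T" using m by (simp_all add: t_def)
  have t_bounds: "0 \<le> t j" "t j \<le> T" if "j \<le> m" for j
    using that m T0 by (auto simp: t_def divide_simps mult_left_mono)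
  have t_mono: "t j \<le> t (Suc j)" for j
    using T0 by (auto simp: t_def intro!: divide_right_mono mult_left_mono)
  have t_step: "t (Suc j) - t j = T / real m" for j
    using m by (simp add: t_def field_simps)
  define ind where "ind j p = (indicator {..t j} (snd p) :: real)" for j and p :: "real \<times> real"
  define E where "E x = \<epsilon> + 2 * C * (1 - cutoff R x)" for x
  have C0: "C \<ge> 0"
    using f(2)[of "(0, 0)"] T0 by auto
  have E0: "E x \<ge> \<epsilon>" "E x \<ge> 0" for x
    using C0 \<epsilon> cutoff_bounds(2)[of R x] by (auto simp: E_def)
  have close: "\<bar>f (x, s) - f (x, r)\<bar> \<le> E x" if "s \<in> {0..T}" "r \<in> {0..T}" "\<bar>s - r\<bar> \<le> T / real m" for x s r
  proof (cases "\<bar>x\<bar> \<le> R + 1")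
    case True
    then show ?thesis
      using modulus[OF True that] E0(1)[of x] by linarith
  next
    case False
    then have "cutoff R x = 0" by (intro cutoff_eq_0) auto
    then show ?thesis
      using f(2)[of "(x, s)"] f(2)[of "(x, r)"] that \<epsilon> by (simp add: E_def abs_le_iff)
  qed
  define g where "g p = f (fst p, 0) * ind 0 p + (\<Sum>j<m. f (fst p, t (Suc j)) * (ind (Suc j) p - ind j p))" for p
  have slice: "continuous_on UNIV (\<lambda>x. f (x, r))" if "r \<in> {0..T}" for r
    using that by (intro continuous_on_compose2[OF f(1)] continuous_intros) auto
  have pointwise: "\<bar>f p - g p\<bar> \<le> E (fst p)" if p: "p \<in> space (strip T)" for p
  proof -
    obtain x s where xs: "p = (x, s)" "0 \<le> s" "s \<le> T"
      using p by (auto simp: space_strip[OF T])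
    have ind_mono: "0 \<le> ind (Suc j) p - ind j p" for j
      using t_mono[of j] by (auto simp: ind_def indicator_def)
    \<comment> \<open>A telescoping partition of unity; it reduces the pointwise estimate to the one slab that contains \<open>p\<close>.\<close>
    have total: "ind 0 p + (\<Sum>j<m. ind (Suc j) p - ind j p) = 1"
    proof -
      have "(\<Sum>j<m. ind (Suc j) p - ind j p) = ind m p - ind 0 p"
        by (rule sum_lessThan_telescope)
      then show ?thesis
        using xs by (simp add: ind_def t)
    qed
    have split: "c = c * ind 0 p + (\<Sum>j<m. c * (ind (Suc j) p - ind j p))" for c
      unfolding sum_distrib_left[symmetric] distrib_left[symmetric] total by simp
    have "f p - g p = (f p - f (x, 0)) * ind 0 p + (\<Sum>j<m. (f p - f (x, t (Suc j))) * (ind (Suc j) p - ind j p))"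
      by (subst split[of "f p"]) (simp add: g_def xs(1) left_diff_distrib sum_subtractf)
    also have "\<bar>\<dots>\<bar> \<le> \<bar>(f p - f (x, 0)) * ind 0 p\<bar> + \<bar>\<Sum>j<m. (f p - f (x, t (Suc j))) * (ind (Suc j) p - ind j p)\<bar>"
      by (rule abs_triangle_ineq)
    also have "\<dots> \<le> E x * ind 0 p + (\<Sum>j<m. E x * (ind (Suc j) p - ind j p))"
    proof (rule add_mono)
      show "\<bar>(f p - f (x, 0)) * ind 0 p\<bar> \<le> E x * ind 0 p"
        using xs E0(2)[of x] by (cases "s = 0") (auto simp: ind_def indicator_def t)
      have "\<bar>\<Sum>j<m. (f p - f (x, t (Suc j))) * (ind (Suc j) p - ind j p)\<bar>
          \<le> (\<Sum>j<m. \<bar>(f p - f (x, t (Suc j))) * (ind (Suc j) p - ind j p)\<bar>)"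
        by (rule sum_abs)
      also have "\<dots> \<le> (\<Sum>j<m. E x * (ind (Suc j) p - ind j p))"
      proof (rule sum_mono)
        fix j assume j: "j \<in> {..<m}"
        show "\<bar>(f p - f (x, t (Suc j))) * (ind (Suc j) p - ind j p)\<bar> \<le> E x * (ind (Suc j) p - ind j p)"
        proof (cases "ind (Suc j) p - ind j p = 0")
          case False
          then have "t j < s" "s \<le> t (Suc j)"
            using t_mono[of j] xs(1) by (cases "s \<le> t j"; cases "s \<le> t (Suc j)"; simp add: ind_def)+
          then have "\<bar>f p - f (x, t (Suc j))\<bar> \<le> E x"
            using xs t_step[of j] t_bounds[of "Suc j"] j unfolding xs(1) by (intro close) auto
          then show ?thesis
            using ind_mono[of j] by (simp add: abs_mult mult_right_mono)
        qed simp
      qed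
      finally show "\<bar>\<Sum>j<m. (f p - f (x, t (Suc j))) * (ind (Suc j) p - ind j p)\<bar>
          \<le> (\<Sum>j<m. E x * (ind (Suc j) p - ind j p))" .
    qed
    also have "\<dots> = E (fst p)"
      using split[of "E x"] xs(1) by simp
    finally show ?thesis .
  qed
  have int_f: "integrable (strip T) f"
    using f(2) continuous_measurable_strip[OF T f(1)]
    by (intro S.integrable_const_bound[of _ C] AE_I2) (auto simp: space_strip[OF T])
  have ind_measurable: "ind j \<in> borel_measurable (strip T)" for j
  proof -
    have snd: "snd \<in> borel_measurable (strip T)"
      by (intro continuous_measurable_strip T continuous_intros)
    have "{..t j} \<in> sets borel" by simp
    then show ?thesis
      unfolding ind_def by (intro measurable_compose[OF snd] borel_measurable_indicator)
  qed
  have int_slice: "integrable (strip T) (\<lambda>p. f (fst p, r) * ind j p)" if r: "r \<in> {0..T}" for r j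
  proof (rule S.integrable_const_bound[of _ C])
    have "norm (f (fst p, r) * ind j p) \<le> C" for p
      using f(2)[of "(fst p, r)"] r C0 by (auto simp: ind_def indicator_def)
    then show "AE p in strip T. norm (f (fst p, r) * ind j p) \<le> C" by simp
    have "(\<lambda>p. f (fst p, r)) \<in> borel_measurable (strip T)"
      by (intro continuous_measurable_strip T continuous_on_compose2[OF slice[OF r]] continuous_intros) auto
    then show "(\<lambda>p. f (fst p, r) * ind j p) \<in> borel_measurable (strip T)"
      using ind_measurable by (intro borel_measurable_times)
  qed
  have integral_slice: "(LINT p|strip T. f (fst p, r) * ind j p) = (LINT x|\<eta> (t j). f (x, r))"
    if "r \<in> {0..T}" "j \<le> m" for r j
    unfolding ind_def by (rule integral_fst_until[OF T t_bounds[OF that(2)] slice[OF that(1)]])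
  have t_in: "t j \<in> {0..T}" if "j \<le> m" for j
    using t_bounds[OF that] by simp
  have int_g: "integrable (strip T) g" and integral_g: "integral\<^sup>L (strip T) g = step_integral f T m"
  proof -
    have int: "integrable (strip T) (\<lambda>p. f (fst p, t (Suc j)) * (ind (Suc j) p - ind j p))"
      and eq: "(LINT p|strip T. f (fst p, t (Suc j)) * (ind (Suc j) p - ind j p)) =
        (LINT x|\<eta> (t (Suc j)). f (x, t (Suc j))) - (LINT x|\<eta> (t j). f (x, t (Suc j)))" if "j < m" for j
      using int_slice[OF t_in[of "Suc j"]] integral_slice[OF t_in[of "Suc j"]] that
      by (simp_all add: right_diff_distrib)
    have int0: "integrable (strip T) (\<lambda>p. f (fst p, 0) * ind 0 p)"
      and eq0: "(LINT p|strip T. f (fst p, 0) * ind 0 p) = (LINT x|\<eta> 0. f (x, 0))"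
      using int_slice[of 0 0] integral_slice[of 0 0] T0 t by simp_all
    show "integrable (strip T) g"
      unfolding g_def using int int0
      by (intro Bochner_Integration.integrable_add Bochner_Integration.integrable_sum) auto
    have "integral\<^sup>L (strip T) g = (LINT x|\<eta> 0. f (x, 0)) +
        (\<Sum>j<m. (LINT x|\<eta> (t (Suc j)). f (x, t (Suc j))) - (LINT x|\<eta> (t j). f (x, t (Suc j))))"
      unfolding g_def using int int0 eq eq0
      by (subst Bochner_Integration.integral_add) (auto simp: Bochner_Integration.integral_sum)
    then show "integral\<^sup>L (strip T) g = step_integral f T m"
      by (simp add: step_integral_def t_def)
  qed
  have cont_E: "continuous_on UNIV E"
    unfolding E_def by (intro continuous_intros continuous_on_subset[OF continuous_cutoff]) auto
  have "\<bar>(LINT p|strip T. f p) - step_integral f T m\<bar> = \<bar>LINT p|strip T. f p - g p\<bar>"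
    using int_f int_g integral_g by simp
  also have "\<dots> \<le> (LINT p|strip T. \<bar>f p - g p\<bar>)"
    by (rule integral_abs_bound)
  also have "\<dots> \<le> (LINT p|strip T. E (fst p))"
  proof (rule integral_mono)
    show "integrable (strip T) (\<lambda>p. \<bar>f p - g p\<bar>)"
      using int_f int_g by simp
    show "integrable (strip T) (\<lambda>p. E (fst p))"
    proof (rule S.integrable_const_bound[of _ "\<epsilon> + 2 * C"])
      have "norm (E x) \<le> \<epsilon> + 2 * C" for x
        using E0(2)[of x] cutoff_bounds(1)[of R x] C0 mult_left_mono[of "1 - cutoff R x" 1 "2 * C"] by (simp add: E_def)
      then show "AE p in strip T. norm (E (fst p)) \<le> \<epsilon> + 2 * C" by simp
      show "(\<lambda>p. E (fst p)) \<in> borel_measurable (strip T)"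
        by (intro continuous_measurable_strip T continuous_on_compose2[OF cont_E] continuous_intros) auto
    qed
  qed (rule pointwise)
  also have "\<dots> = integral\<^sup>L (\<eta> T) E"
    by (rule integral_fst_strip[OF T cont_E])
  also have "\<dots> = \<epsilon> * measure (\<eta> T) UNIV + 2 * C * (LINT x|\<eta> T. 1 - cutoff R x)"
    using \<eta>.integrable_bounded_continuous[OF continuous_cutoff bounded_cutoff, of R]
      finite_borel_measure_space[OF \<eta>.finite_borel_measure_axioms]
    unfolding E_def by simp
  finally show ?thesis .
qed

end

lemma strip_convergence_imp_pointwise:
  assumes st: "\<And>n. space_time I (\<gamma>n n) (\<eta>n n) (Hn n)" "space_time I \<gamma> \<eta> H" and t: "t \<in> I"
    and lim: "weakly_converges_on (UNIV \<times> {0..t}) (\<lambda>n. restrict_space (Hn n) (UNIV \<times> {0..t}))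
                (restrict_space H (UNIV \<times> {0..t}))"
  shows "weakly_converges_on UNIV (\<lambda>n. \<eta>n n t) (\<eta> t)"
  unfolding weakly_converges_on_def
proof (intro allI impI, elim conjE)
  fix f :: "real \<Rightarrow> real"
  assume f: "continuous_on UNIV f" "bounded (range f)"
  have "continuous_on (UNIV \<times> {0..t}) (\<lambda>p. f (fst p))"
    by (intro continuous_on_compose2[OF f(1)] continuous_intros) auto
  moreover have "bounded ((\<lambda>p. f (fst p)) ` (UNIV \<times> {0..t}))"
    by (rule bounded_subset[OF f(2)]) auto
  ultimately show "(\<lambda>n. integral\<^sup>L (\<eta>n n t) f) \<longlonglongrightarrow> integral\<^sup>L (\<eta> t) f"
    using lim space_time.integral_fst_strip[OF st(1) t f(1)] space_time.integral_fst_strip[OF st(2) t f(1)]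
    by (auto simp: weakly_converges_on_def)
qed

text \<open>For a fixed partition the step integrals involve finitely many times and converge; the mesh and the
  cutoff are chosen from the limit alone, so they serve all \<open>n\<close>.\<close>

lemma pointwise_imp_strip_convergence:
  assumes st: "\<And>n. space_time I (\<gamma>n n) (\<eta>n n) (Hn n)" "space_time I \<gamma> \<eta> H" and T: "T \<in> I"
    and lim: "\<And>t. t \<in> I \<Longrightarrow> weakly_converges_on UNIV (\<lambda>n. \<eta>n n t) (\<eta> t)"
  shows "weakly_converges_on (UNIV \<times> {0..T}) (\<lambda>n. restrict_space (Hn n) (UNIV \<times> {0..T}))
           (restrict_space H (UNIV \<times> {0..T}))"
  unfolding weakly_converges_on_def
proof (intro allI impI, elim conjE)
  fix f :: "real \<times> real \<Rightarrow> real"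
  assume f: "continuous_on (UNIV \<times> {0..T}) f" "bounded (f ` (UNIV \<times> {0..T}))"
  interpret st: space_time I \<gamma> \<eta> H by (rule st)
  have fin: "finite_borel_measure (\<eta>n n t)" "finite_borel_measure (\<eta> t)" if "t \<in> I" for n t
    using st that by (auto simp: space_time_def intro: generating_familyD(2))
  have T0: "0 \<le> T" by (rule time_intervalD(2)[OF st.I T])
  have sub: "{0..T} \<subseteq> I"
    using time_intervalD(3)[OF st.I time_intervalD(1)[OF st.I] T] by auto
  obtain C where C: "\<And>p. p \<in> UNIV \<times> {0..T} \<Longrightarrow> \<bar>f p\<bar> \<le> C"
    using f(2) unfolding bounded_iff by (metis imageI real_norm_def)
  have C0: "C \<ge> 0"
    using C[of "(0, 0)"] T0 by auto
  show "(\<lambda>n. integral\<^sup>L (restrict_space (Hn n) (UNIV \<times> {0..T})) f)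
      \<longlonglongrightarrow> integral\<^sup>L (restrict_space H (UNIV \<times> {0..T})) f"
  proof (rule tendsto_by_approximation)
    fix e :: real assume e: "e > 0"
    have "e / (4 * (1 + C)) > 0"
      using e C0 by simp
    then obtain R where R: "R \<ge> 0" "(LINT x|\<eta> T. 1 - cutoff R x) < e / (4 * (1 + C))"
      by (rule integral_outside_cutoff_small[OF fin(2)[OF T]])
    define \<epsilon> where "\<epsilon> = e / (2 * (1 + measure (\<eta> T) UNIV))"
    have pos: "1 + measure (\<eta> T) UNIV > 0"
      by (simp add: add_pos_nonneg)
    have \<epsilon>: "\<epsilon> > 0"
      using e pos by (simp add: \<epsilon>_def)
    have "uniformly_continuous_on (cball 0 (R + 1) \<times> {0..T}) f"
      by (intro compact_uniformly_continuous continuous_on_subset[OF f(1)] compact_Times) auto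
    then obtain \<delta> where \<delta>: "\<delta> > 0"
      "\<And>p q. p \<in> cball 0 (R + 1) \<times> {0..T} \<Longrightarrow> q \<in> cball 0 (R + 1) \<times> {0..T} \<Longrightarrow> dist p q < \<delta> \<Longrightarrow> dist (f p) (f q) < \<epsilon>"
      using \<epsilon> unfolding uniformly_continuous_on_def by metis
    obtain m :: nat where m: "T / \<delta> < real m"
      using reals_Archimedean2 by blast
    have m0: "m > 0"
      using m T0 \<delta>(1) by (cases m) (auto simp: divide_less_0_iff not_less[symmetric])
    have mesh: "T / real m < \<delta>"
      using m m0 \<delta>(1) by (simp add: field_simps)
    have modulus: "\<bar>f (x, s) - f (x, t)\<bar> \<le> \<epsilon>"
      if "\<bar>x\<bar> \<le> R + 1" "s \<in> {0..T}" "t \<in> {0..T}" "\<bar>s - t\<bar> \<le> T / real m" for x s t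
    proof -
      have "dist (x, s) (x, t) < \<delta>"
        using that(4) mesh by (simp add: dist_Pair_Pair dist_real_def)
      then show ?thesis
        using \<delta>(2)[of "(x, s)" "(x, t)"] that by (simp add: dist_real_def)
    qed
    let ?b = "\<lambda>n. space_time.step_integral (\<eta>n n) f T m"
    let ?d = "\<lambda>\<mu>. \<epsilon> * measure \<mu> UNIV + 2 * C * (LINT x|\<mu>. 1 - cutoff R x)"
    have "\<bar>integral\<^sup>L (restrict_space (Hn n) (UNIV \<times> {0..T})) f - ?b n\<bar> \<le> ?d (\<eta>n n T)" for n
      using space_time.step_integral_close[OF st(1) T m0 f(1) C modulus] \<epsilon> by simp
    moreover have "\<bar>integral\<^sup>L (restrict_space H (UNIV \<times> {0..T})) f - st.step_integral f T m\<bar> \<le> ?d (\<eta> T)"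
      using st.step_integral_close[OF T m0 f(1) C modulus] \<epsilon> by simp
    moreover have "?b \<longlonglongrightarrow> st.step_integral f T m"
    proof -
      have slice: "(\<lambda>n. LINT x|\<eta>n n s. f (x, t)) \<longlonglongrightarrow> (LINT x|\<eta> s. f (x, t))" if "s \<in> {0..T}" "t \<in> {0..T}" for s t
      proof -
        have "continuous_on UNIV (\<lambda>x. f (x, t))"
          using that by (intro continuous_on_compose2[OF f(1)] continuous_intros) auto
        moreover have "bounded (range (\<lambda>x. f (x, t)))"
          by (rule bounded_subset[OF f(2)]) (use that in auto)
        ultimately show ?thesis
          using lim[of s] that sub by (auto simp: weakly_converges_on_def)
      qed
      have grid: "T * real j / real m \<in> {0..T}" if "j \<le> m" for j
        using that m0 T0 by (auto simp: divide_simps mult_left_mono)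
      show ?thesis
        unfolding space_time.step_integral_def[OF st(1)] st.step_integral_def
        using T0 by (intro tendsto_intros slice grid) auto
    qed
    moreover have "(\<lambda>n. ?d (\<eta>n n T)) \<longlonglongrightarrow> ?d (\<eta> T)"
    proof -
      have "(\<lambda>n. LINT x|\<eta>n n T. 1 - cutoff R x) \<longlonglongrightarrow> (LINT x|\<eta> T. 1 - cutoff R x)"
      proof -
        have "continuous_on UNIV (\<lambda>x. 1 - cutoff R x)"
          by (intro continuous_intros continuous_on_subset[OF continuous_cutoff]) auto
        moreover have "norm (1 - cutoff R x) \<le> 1" for x
          using cutoff_bounds[of R x] by simp
        then have "bounded (range (\<lambda>x. 1 - cutoff R x))"
          unfolding bounded_iff by blast
        ultimately show ?thesis
          using lim[OF T] by (auto simp: weakly_converges_on_def)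
      qed
      then show ?thesis
        using fin[OF T] lim[OF T] by (intro tendsto_intros weakly_converges_on_total_mass) auto
    qed
    moreover have "?d (\<eta> T) < e"
    proof -
      have "\<epsilon> * measure (\<eta> T) UNIV \<le> \<epsilon> * (1 + measure (\<eta> T) UNIV)"
        using \<epsilon> by (intro mult_left_mono) auto
      also have "\<dots> = e / 2"
      proof -
        have "e / (2 * c) * c = e / 2" if "c > 0" for c
          using that by simp
        from this[OF pos] show ?thesis
          by (simp only: \<epsilon>_def)
      qed
      finally have "\<epsilon> * measure (\<eta> T) UNIV \<le> e / 2" .
      moreover have "2 * C * (LINT x|\<eta> T. 1 - cutoff R x) < e / 2"
      proof -
        have "0 \<le> (LINT x|\<eta> T. 1 - cutoff R x)"
          using cutoff_bounds[of R] by (intro Bochner_Integration.integral_nonneg) auto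
        then have "2 * C * (LINT x|\<eta> T. 1 - cutoff R x) \<le> 2 * (1 + C) * (LINT x|\<eta> T. 1 - cutoff R x)"
          by (intro mult_right_mono) auto
        also have "\<dots> < 2 * (1 + C) * (e / (4 * (1 + C)))"
          using R(2) C0 by (intro mult_strict_left_mono) auto
        also have "\<dots> = e / 2"
        proof -
          have "2 * c * (e / (4 * c)) = e / 2" if "c > 0" for c
            using that by simp
          from this[of "1 + C"] show ?thesis
            using C0 by linarith
        qed
        finally show ?thesis .
      qed
      ultimately show ?thesis by linarith
    qed
    ultimately show "\<exists>b b' d d'. b \<longlonglongrightarrow> b' \<and> d \<longlonglongrightarrow> d' \<and>
       (\<forall>n. \<bar>integral\<^sup>L (restrict_space (Hn n) (UNIV \<times> {0..T})) f - b n\<bar> \<le> d n) \<and>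
       \<bar>integral\<^sup>L (restrict_space H (UNIV \<times> {0..T})) f - b'\<bar> \<le> d' \<and> d' < e"
      by (intro exI[of _ ?b] exI[of _ "st.step_integral f T m"] exI[of _ "\<lambda>n. ?d (\<eta>n n T)"] exI[of _ "?d (\<eta> T)"])
        blast
  qed
qed

section \<open>Boolean convolution hemigroups\<close>

lemma weakly_continuous_on_sequence:
  fixes x :: "nat \<Rightarrow> 'a::metric_space"
  assumes "weakly_continuous_on S M" "\<And>k. x k \<in> S" "x \<longlonglongrightarrow> l" "l \<in> S"
  shows "weakly_converges_on UNIV (\<lambda>k. M (x k)) (M l)"
  unfolding weakly_converges_on_def
proof (intro allI impI)
  fix f :: "real \<Rightarrow> real"
  assume "continuous_on UNIV f \<and> bounded (range f)"
  then have "continuous_on S (\<lambda>\<tau>. integral\<^sup>L (M \<tau>) f)"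
    using assms(1) by (auto simp: weakly_continuous_on_def)
  then show "(\<lambda>k. integral\<^sup>L (M (x k)) f) \<longlonglongrightarrow> integral\<^sup>L (M l) f"
    by (rule continuous_on_tendsto_compose[OF _ assms(3,4)]) (simp add: assms(2))
qed

lemma weak_locally_uniform_imp_sequences:
  fixes x :: "nat \<Rightarrow> 'a::heine_borel"
  assumes "weakly_converges_locally_uniformly S M N" "weakly_continuous_on S N"
    and "filterlim r at_top sequentially" "\<And>k. x k \<in> S" "x \<longlonglongrightarrow> l" "l \<in> S"
  shows "weakly_converges_on UNIV (\<lambda>k. M (r k) (x k)) (N l)"
  unfolding weakly_converges_on_def
proof (intro allI impI)
  fix f :: "real \<Rightarrow> real"
  assume "continuous_on UNIV f \<and> bounded (range f)"
  then have "locally_uniform_limit S (\<lambda>n \<tau>. integral\<^sup>L (M n \<tau>) f) (\<lambda>\<tau>. integral\<^sup>L (N \<tau>) f)"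
    "continuous_on S (\<lambda>\<tau>. integral\<^sup>L (N \<tau>) f)"
    using assms(1,2) by (auto simp: weakly_continuous_on_def weakly_converges_locally_uniformly_def)
  then show "(\<lambda>k. integral\<^sup>L (M (r k) (x k)) f) \<longlonglongrightarrow> integral\<^sup>L (N l) f"
    by (rule locally_uniform_limit_imp_sequences[OF _ _ assms(3-6)])
qed

lemma sequences_imp_weak_locally_uniform:
  fixes S :: "'a::metric_space set"
  assumes N: "weakly_continuous_on S N"
    and *: "\<And>r x l. strict_mono r \<Longrightarrow> (\<And>k. x k \<in> S) \<Longrightarrow> x \<longlonglongrightarrow> l \<Longrightarrow> l \<in> S \<Longrightarrow>
              weakly_converges_on UNIV (\<lambda>k. M (r k) (x k)) (N l)"
  shows "weakly_converges_locally_uniformly S M N"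
  unfolding weakly_converges_locally_uniformly_def
proof (intro allI impI)
  fix f :: "real \<Rightarrow> real"
  assume f: "continuous_on UNIV f \<and> bounded (range f)"
  show "locally_uniform_limit S (\<lambda>n \<tau>. integral\<^sup>L (M n \<tau>) f) (\<lambda>\<tau>. integral\<^sup>L (N \<tau>) f)"
  proof (rule sequences_imp_locally_uniform_limit)
    show "continuous_on S (\<lambda>\<tau>. integral\<^sup>L (N \<tau>) f)"
      using N f by (auto simp: weakly_continuous_on_def)
    show "(\<lambda>k. integral\<^sup>L (M (r k) (x k)) f) \<longlonglongrightarrow> integral\<^sup>L (N l) f"
      if "strict_mono r" "\<And>k. x k \<in> S" "x \<longlonglongrightarrow> l" "l \<in> S" for r x l
      using *[OF that] f by (auto simp: weakly_converges_on_def)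
  qed
qed

lemma energy_tendsto:
  assumes \<mu>: "\<And>n. real_distribution (\<mu> n)" "real_distribution \<mu>'"
    and lim: "weakly_converges_on UNIV \<mu> \<mu>'"
    and z: "\<And>n. z n \<in> upper_half_plane" "z \<longlonglongrightarrow> z'" "z' \<in> upper_half_plane"
  shows "(\<lambda>n. energy (\<mu> n) (z n)) \<longlonglongrightarrow> energy \<mu>' z'"
  unfolding energy_def reciprocal_cauchy_transform_def
  using real_distribution.finite_borel_measure_M \<mu> cauchy_transform_nonzero[OF \<mu>(2) z(3)]
  by (intro tendsto_intros cauchy_transform_tendsto lim z) auto

text \<open>The energies determine the reciprocals of the Cauchy transforms, which have no zeros; through
  \<open>(1 + z\<^sup>2) G(z) - z\<close> the Nevanlinna transforms converge.\<close>

lemma weakly_converges_on_if_energy_tendsto: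
  assumes \<mu>: "\<And>n. real_distribution (\<mu> n)" "real_distribution \<mu>'"
    and lim: "\<And>z. z \<in> upper_half_plane \<Longrightarrow> (\<lambda>n. energy (\<mu> n) z) \<longlonglongrightarrow> energy \<mu>' z"
  shows "weakly_converges_on UNIV \<mu> \<mu>'"
proof -
  have fin: "finite_borel_measure (\<mu> n)" "finite_borel_measure \<mu>'" for n
    using \<mu> real_distribution.finite_borel_measure_M by auto
  have mass: "measure \<nu> UNIV = 1" if "real_distribution \<nu>" for \<nu>
  proof -
    interpret real_distribution \<nu> by fact
    show ?thesis using prob_space by simp
  qed
  have "open upper_half_plane"
    unfolding upper_half_plane_def by (rule open_halfspace_Im_gt)
  moreover have "\<i> \<in> upper_half_plane"
    by (simp add: upper_half_plane_def)
  ultimately have i: "\<i> \<in> upper_half_plane" "\<i> islimpt upper_half_plane"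
    by (auto intro: open_imp_islimpt)
  have "(\<lambda>n. of_real 0 + nevanlinna_transform (\<mu> n) z) \<longlonglongrightarrow> of_real 0 + nevanlinna_transform \<mu>' z"
    if z: "z \<in> upper_half_plane" for z
  proof -
    have "(\<lambda>n. z - energy (\<mu> n) z) \<longlonglongrightarrow> z - energy \<mu>' z"
      by (intro tendsto_intros lim z)
    then have "(\<lambda>n. 1 / cauchy_transform (\<mu> n) z) \<longlonglongrightarrow> 1 / cauchy_transform \<mu>' z"
      by (simp add: energy_def reciprocal_cauchy_transform_def)
    then have "(\<lambda>n. 1 / (1 / cauchy_transform (\<mu> n) z)) \<longlonglongrightarrow> 1 / (1 / cauchy_transform \<mu>' z)"
      by (rule tendsto_divide[OF tendsto_const]) (simp add: cauchy_transform_nonzero[OF \<mu>(2) z])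
    then have "(\<lambda>n. cauchy_transform (\<mu> n) z) \<longlonglongrightarrow> cauchy_transform \<mu>' z"
      by simp
    then have "(\<lambda>n. (1 + z\<^sup>2) * cauchy_transform (\<mu> n) z - z) \<longlonglongrightarrow> (1 + z\<^sup>2) * cauchy_transform \<mu>' z - z"
      by (intro tendsto_intros)
    then show ?thesis
      by (simp add: nevanlinna_transform_eq_cauchy_transform[OF _ z] fin mass \<mu>)
  qed
  from nevanlinna_continuity(2)[OF fin subset_refl i this] show ?thesis .
qed

lemma boolean_hemigroup_with_generatorD:
  assumes I: "time_interval I" and b: "boolean_hemigroup_with_generator I \<bb> \<gamma> \<eta>"
  shows "generating_family I \<gamma> \<eta>" "weakly_continuous_on (ordered_pairs I) \<bb>"
    "(s, t) \<in> ordered_pairs I \<Longrightarrow> real_distribution (\<bb> (s, t))"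
    "t \<in> I \<Longrightarrow> z \<in> upper_half_plane \<Longrightarrow> energy (\<bb> (0, t)) z = of_real (\<gamma> t) + nevanlinna_transform (\<eta> t) z"
    "(s, t) \<in> ordered_pairs I \<Longrightarrow> z \<in> upper_half_plane \<Longrightarrow>
       energy (\<bb> (s, t)) z = energy (\<bb> (0, t)) z - energy (\<bb> (0, s)) z"
proof -
  show "generating_family I \<gamma> \<eta>" "weakly_continuous_on (ordered_pairs I) \<bb>"
    "(s, t) \<in> ordered_pairs I \<Longrightarrow> real_distribution (\<bb> (s, t))"
    "t \<in> I \<Longrightarrow> z \<in> upper_half_plane \<Longrightarrow> energy (\<bb> (0, t)) z = of_real (\<gamma> t) + nevanlinna_transform (\<eta> t) z"
    using b by (auto simp: boolean_hemigroup_with_generator_def boolean_hemigroup_def nevanlinna_transform_def)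
  assume st: "(s, t) \<in> ordered_pairs I" and z: "z \<in> upper_half_plane"
  have "is_boolean_convolution (\<bb> (0, s)) (\<bb> (s, t)) (\<bb> (0, t))"
  proof -
    have "\<forall>s\<in>I. \<forall>t\<in>I. \<forall>u\<in>I. s \<le> t \<and> t \<le> u \<longrightarrow> is_boolean_convolution (\<bb> (s, t)) (\<bb> (t, u)) (\<bb> (s, u))"
      using b by (simp add: boolean_hemigroup_with_generator_def boolean_hemigroup_def)
    from this[rule_format, of 0 s t] show ?thesis
      using st time_intervalD(1,2)[OF I] by (simp add: ordered_pairs_def)
  qed
  then show "energy (\<bb> (s, t)) z = energy (\<bb> (0, t)) z - energy (\<bb> (0, s)) z"
    using z by (simp add: is_boolean_convolution_def)
qed

lemma ordered_pairs_from_0: "time_interval I \<Longrightarrow> t \<in> I \<Longrightarrow> (0, t) \<in> ordered_pairs I"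
  by (simp add: ordered_pairs_def time_intervalD(1,2))

lemma continuous_on_hemigroup_energy:
  assumes I: "time_interval I" and b: "boolean_hemigroup_with_generator I \<bb> \<gamma> \<eta>"
  shows "continuous_on (upper_half_plane \<times> I) (\<lambda>(z, t). energy (\<bb> (0, t)) z)"
  unfolding continuous_on_sequentially
proof (intro allI ballI impI, elim conjE)
  fix x :: "nat \<Rightarrow> complex \<times> real" and a
  assume a: "a \<in> upper_half_plane \<times> I" and x: "\<forall>n. x n \<in> upper_half_plane \<times> I" and lim: "x \<longlonglongrightarrow> a"
  note D = boolean_hemigroup_with_generatorD[OF I b]
  have mem: "fst (x n) \<in> upper_half_plane" "snd (x n) \<in> I" "fst a \<in> upper_half_plane" "snd a \<in> I" for n
    using x a by (auto simp: mem_Times_iff)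
  have "(\<lambda>n. energy (\<bb> (0, snd (x n))) (fst (x n))) \<longlonglongrightarrow> energy (\<bb> (0, snd a)) (fst a)"
  proof (rule energy_tendsto)
    show "weakly_converges_on UNIV (\<lambda>n. \<bb> (0, snd (x n))) (\<bb> (0, snd a))"
      by (rule weakly_continuous_on_sequence[OF D(2), of "\<lambda>n. (0, snd (x n))" "(0, snd a)"])
        (intro ordered_pairs_from_0 I mem tendsto_intros lim)+
  qed (intro D(3) ordered_pairs_from_0 I mem tendsto_intros lim)+
  then show "((\<lambda>(z, t). energy (\<bb> (0, t)) z) \<circ> x) \<longlonglongrightarrow> (\<lambda>(z, t). energy (\<bb> (0, t)) z) a"
    by (simp add: o_def case_prod_beta)
qed

theorem theorem7p6:
  fixes I :: "real set" and A :: "complex set"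
    and \<bb>n :: "nat \<Rightarrow> real \<times> real \<Rightarrow> real measure" and \<bb> :: "real \<times> real \<Rightarrow> real measure"
    and \<gamma>n :: "nat \<Rightarrow> real \<Rightarrow> real" and \<gamma> :: "real \<Rightarrow> real"
    and \<eta>n :: "nat \<Rightarrow> real \<Rightarrow> real measure" and \<eta> :: "real \<Rightarrow> real measure"
    and Hn :: "nat \<Rightarrow> (real \<times> real) measure" and H :: "(real \<times> real) measure"
  assumes "time_interval I"
    and "A \<subseteq> upper_half_plane" and "\<exists>z\<in>upper_half_plane. z islimpt A"
    and "\<And>n. boolean_hemigroup_with_generator I (\<bb>n n) (\<gamma>n n) (\<eta>n n)"
    and "boolean_hemigroup_with_generator I \<bb> \<gamma> \<eta>"
    and "\<And>n. is_space_time_measure I (\<eta>n n) (Hn n)"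
    and "is_space_time_measure I \<eta> H"
  defines "cond1 \<equiv> weakly_converges_locally_uniformly (ordered_pairs I) \<bb>n \<bb>"
    and "cond2 \<equiv> locally_uniform_limit (upper_half_plane \<times> I)
           (\<lambda>n (z, t). energy (\<bb>n n (0, t)) z) (\<lambda>(z, t). energy (\<bb> (0, t)) z)"
    and "cond3 \<equiv> \<forall>z\<in>A. locally_uniform_limit I
           (\<lambda>n t. energy (\<bb>n n (0, t)) z) (\<lambda>t. energy (\<bb> (0, t)) z)"
    and "cond4_drift \<equiv> locally_uniform_limit I \<gamma>n \<gamma>"
    and "cond4_i \<equiv> weakly_converges_locally_uniformly I \<eta>n \<eta>"
    and "cond4_ii \<equiv> \<forall>t\<in>I. weakly_converges_on UNIV (\<lambda>n. \<eta>n n t) (\<eta> t)"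
    and "cond4_iii \<equiv> \<forall>T\<in>I. weakly_converges_on (UNIV \<times> {0..T})
           (\<lambda>n. restrict_space (Hn n) (UNIV \<times> {0..T})) (restrict_space H (UNIV \<times> {0..T}))"
  shows "(cond4_i \<longleftrightarrow> cond4_ii) \<and> (cond4_ii \<longleftrightarrow> cond4_iii) \<and>
         (cond1 \<longleftrightarrow> cond2) \<and> (cond2 \<longleftrightarrow> cond3) \<and> (cond3 \<longleftrightarrow> cond4_drift \<and> cond4_i)"
proof -
  note I = \<open>time_interval I\<close> and A = \<open>A \<subseteq> upper_half_plane\<close>
  obtain z0 where z0: "z0 \<in> upper_half_plane" "z0 islimpt A"
    using assms(3) by blast
  note Dn = boolean_hemigroup_with_generatorD[OF I assms(4)]
  note D = boolean_hemigroup_with_generatorD[OF I assms(5)]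
  note cont = continuous_on_hemigroup_energy[OF I assms(5)]
  have cont_z: "continuous_on I (\<lambda>t. energy (\<bb> (0, t)) z)" if "z \<in> upper_half_plane" for z
  proof -
    have "continuous_on I (\<lambda>t. (\<lambda>(z, t). energy (\<bb> (0, t)) z) (z, t))"
      by (rule continuous_on_compose2[OF cont]) (use that in \<open>auto intro!: continuous_intros\<close>)
    then show ?thesis by simp
  qed
  note fin_n = generating_familyD(2)[OF Dn(1)] and fin = generating_familyD(2)[OF D(1)]
  note \<gamma>_cont = generating_familyD(1)[OF D(1)] and \<eta>_cont = generating_family_weakly_continuous[OF D(1)]
  have st: "space_time I (\<gamma>n n) (\<eta>n n) (Hn n)" "space_time I \<gamma> \<eta> H" for n
    using I Dn(1) D(1) assms(6,7) by (auto intro: space_time.intro)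

  have i_iff_ii: "cond4_i \<longleftrightarrow> cond4_ii"
    unfolding cond4_i_def cond4_ii_def
    using pointwise_weak_imp_locally_uniform[of I \<gamma>n \<eta>n \<gamma> \<eta>, OF I Dn(1) D(1)] locally_uniform_imp_pointwise_weak by blast
  have ii_iff_iii: "cond4_ii \<longleftrightarrow> cond4_iii"
    unfolding cond4_ii_def cond4_iii_def
    using strip_convergence_imp_pointwise[of I \<gamma>n \<eta>n Hn \<gamma> \<eta> H, OF st]
      pointwise_imp_strip_convergence[of I \<gamma>n \<eta>n Hn \<gamma> \<eta> H, OF st] by blast

  \<comment> \<open>The energy depends jointly continuously on the law and on \<open>z\<close>; the sequences are taken in \<open>(z, t)\<close>.\<close>
  have 1: cond2 if cond1
    unfolding cond2_def
  proof (rule sequences_imp_locally_uniform_limit[OF cont])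
    fix r :: "nat \<Rightarrow> nat" and x :: "nat \<Rightarrow> complex \<times> real" and l
    assume r: "strict_mono r" and x: "\<And>k. x k \<in> upper_half_plane \<times> I" "x \<longlonglongrightarrow> l" and l: "l \<in> upper_half_plane \<times> I"
    have mem: "fst (x k) \<in> upper_half_plane" "snd (x k) \<in> I" "fst l \<in> upper_half_plane" "snd l \<in> I" for k
      using x(1)[of k] l by (auto simp: mem_Times_iff)
    have "(\<lambda>k. energy (\<bb>n (r k) (0, snd (x k))) (fst (x k))) \<longlonglongrightarrow> energy (\<bb> (0, snd l)) (fst l)"
    proof (rule energy_tendsto)
      show "weakly_converges_on UNIV (\<lambda>k. \<bb>n (r k) (0, snd (x k))) (\<bb> (0, snd l))"
        by (rule weak_locally_uniform_imp_sequences[OF that[unfolded cond1_def] D(2) filterlim_subseq[OF r],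
              of "\<lambda>k. (0, snd (x k))" "(0, snd l)"])
          (intro ordered_pairs_from_0 I mem tendsto_intros x(2))+
    qed (intro Dn(3) D(3) ordered_pairs_from_0 I mem tendsto_intros x(2))+
    then show "(\<lambda>k. (\<lambda>(z, t). energy (\<bb>n (r k) (0, t)) z) (x k)) \<longlonglongrightarrow> (\<lambda>(z, t). energy (\<bb> (0, t)) z) l"
      by (simp add: case_prod_beta)
  qed
  have 2: cond3 if cond2
    unfolding cond3_def locally_uniform_limit_def
  proof (intro ballI allI impI, elim conjE)
    fix z K assume z: "z \<in> A" and K: "compact K" "K \<subseteq> I"
    have "compact ({z} \<times> K)" "{z} \<times> K \<subseteq> upper_half_plane \<times> I"
      using z A K by (auto intro: compact_Times)
    then have "uniform_limit ({z} \<times> K) (\<lambda>n (z, t). energy (\<bb>n n (0, t)) z) (\<lambda>(z, t). energy (\<bb> (0, t)) z) sequentially"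
      using that unfolding cond2_def locally_uniform_limit_def by blast
    from uniform_limit_compose'[OF this, of "Pair z" K]
    show "uniform_limit K (\<lambda>n t. energy (\<bb>n n (0, t)) z) (\<lambda>t. energy (\<bb> (0, t)) z) sequentially"
      by auto
  qed
  \<comment> \<open>For a fixed sequence of times all points of \<open>A\<close> are used at once in the continuity theorem.\<close>
  have 3: "cond4_drift \<and> cond4_i" if cond3
  proof -
    have seq: "(\<lambda>k. \<gamma>n (r k) (t k)) \<longlonglongrightarrow> \<gamma> l \<and> weakly_converges_on UNIV (\<lambda>k. \<eta>n (r k) (t k)) (\<eta> l)"
      if r: "strict_mono r" and t: "\<And>k. t k \<in> I" "t \<longlonglongrightarrow> l" and l: "l \<in> I" for r t l
    proof -
      have "(\<lambda>k. of_real (\<gamma>n (r k) (t k)) + nevanlinna_transform (\<eta>n (r k) (t k)) z)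
          \<longlonglongrightarrow> of_real (\<gamma> l) + nevanlinna_transform (\<eta> l) z" if z: "z \<in> A" for z
      proof -
        have zU: "z \<in> upper_half_plane" using z A by auto
        have "(\<lambda>k. energy (\<bb>n (r k) (0, t k)) z) \<longlonglongrightarrow> energy (\<bb> (0, l)) z"
          using \<open>cond3\<close> z unfolding cond3_def
          by (intro locally_uniform_limit_imp_sequences[OF _ cont_z[OF zU] filterlim_subseq[OF r] t l]) auto
        then show ?thesis
          using Dn(4)[OF t(1) zU] D(4)[OF l zU] by simp
      qed
      from nevanlinna_continuity[OF fin_n[OF t(1)] fin[OF l] A z0 this] show ?thesis by blast
    qed
    then have cond4_drift
      unfolding cond4_drift_def by (intro sequences_imp_locally_uniform_limit[OF \<gamma>_cont]) blast
    moreover from seq have cond4_i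
      unfolding cond4_i_def by (intro sequences_imp_weak_locally_uniform[OF \<eta>_cont]) blast
    ultimately show ?thesis ..
  qed
  have 4: cond2 if "cond4_drift \<and> cond4_i"
    unfolding cond2_def
  proof (rule sequences_imp_locally_uniform_limit[OF cont])
    fix r :: "nat \<Rightarrow> nat" and x :: "nat \<Rightarrow> complex \<times> real" and l
    assume r: "strict_mono r" and x: "\<And>k. x k \<in> upper_half_plane \<times> I" "x \<longlonglongrightarrow> l" and l: "l \<in> upper_half_plane \<times> I"
    have mem: "fst (x k) \<in> upper_half_plane" "snd (x k) \<in> I" "fst l \<in> upper_half_plane" "snd l \<in> I" for k
      using x(1)[of k] l by (auto simp: mem_Times_iff)
    have lims: "(\<lambda>k. fst (x k)) \<longlonglongrightarrow> fst l" "(\<lambda>k. snd (x k)) \<longlonglongrightarrow> snd l"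
      by (intro tendsto_intros x(2))+
    have "(\<lambda>k. \<gamma>n (r k) (snd (x k))) \<longlonglongrightarrow> \<gamma> (snd l)"
      using that unfolding cond4_drift_def
      by (intro locally_uniform_limit_imp_sequences[OF _ \<gamma>_cont filterlim_subseq[OF r] mem(2) lims(2) mem(4)]) auto
    moreover have "weakly_converges_on UNIV (\<lambda>k. \<eta>n (r k) (snd (x k))) (\<eta> (snd l))"
      using that unfolding cond4_i_def
      by (intro weak_locally_uniform_imp_sequences[OF _ \<eta>_cont filterlim_subseq[OF r] mem(2) lims(2) mem(4)]) auto
    then have "(\<lambda>k. nevanlinna_transform (\<eta>n (r k) (snd (x k))) (fst (x k))) \<longlonglongrightarrow> nevanlinna_transform (\<eta> (snd l)) (fst l)"
      by (intro nevanlinna_transform_tendsto[OF fin_n[OF mem(2)] fin[OF mem(4)]] mem lims)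
    ultimately have "(\<lambda>k. of_real (\<gamma>n (r k) (snd (x k))) + nevanlinna_transform (\<eta>n (r k) (snd (x k))) (fst (x k)))
        \<longlonglongrightarrow> of_real (\<gamma> (snd l)) + nevanlinna_transform (\<eta> (snd l)) (fst l)"
      by (intro tendsto_intros)
    then show "(\<lambda>k. (\<lambda>(z, t). energy (\<bb>n (r k) (0, t)) z) (x k)) \<longlonglongrightarrow> (\<lambda>(z, t). energy (\<bb> (0, t)) z) l"
      by (simp add: case_prod_beta Dn(4) D(4) mem)
  qed
  have 5: cond1 if cond2
    unfolding cond1_def
  proof (rule sequences_imp_weak_locally_uniform[OF D(2)])
    fix r :: "nat \<Rightarrow> nat" and x :: "nat \<Rightarrow> real \<times> real" and l
    assume r: "strict_mono r" and x: "\<And>k. x k \<in> ordered_pairs I" "x \<longlonglongrightarrow> l" and l: "l \<in> ordered_pairs I"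
    have lims: "(\<lambda>k. fst (x k)) \<longlonglongrightarrow> fst l" "(\<lambda>k. snd (x k)) \<longlonglongrightarrow> snd l"
      by (intro tendsto_intros x(2))+
    have mem: "fst (x k) \<in> I" "snd (x k) \<in> I" "fst l \<in> I" "snd l \<in> I" for k
      using x(1)[of k] l by (auto simp: ordered_pairs_def)
    have pair: "(fst (x k), snd (x k)) \<in> ordered_pairs I" "(fst l, snd l) \<in> ordered_pairs I" for k
      using x(1)[of k] l by simp_all
    have "weakly_converges_on UNIV (\<lambda>k. \<bb>n (r k) (fst (x k), snd (x k))) (\<bb> (fst l, snd l))"
    proof (rule weakly_converges_on_if_energy_tendsto)
      fix z assume z: "z \<in> upper_half_plane"
      have from_0: "(\<lambda>k. energy (\<bb>n (r k) (0, t k)) z) \<longlonglongrightarrow> energy (\<bb> (0, u)) z"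
        if t: "\<And>k. t k \<in> I" "t \<longlonglongrightarrow> u" "u \<in> I" for t u
      proof -
        have "(\<lambda>k. (z, t k)) \<longlonglongrightarrow> (z, u)"
          by (intro tendsto_Pair tendsto_const t(2))
        from locally_uniform_limit_imp_sequences[OF \<open>cond2\<close>[unfolded cond2_def] cont filterlim_subseq[OF r] _ this]
        show ?thesis
          using z t by simp
      qed
      show "(\<lambda>k. energy (\<bb>n (r k) (fst (x k), snd (x k))) z) \<longlonglongrightarrow> energy (\<bb> (fst l, snd l)) z"
        unfolding Dn(5)[OF pair(1) z] D(5)[OF pair(2) z]
        by (intro tendsto_diff from_0 mem lims)
    qed (intro Dn(3) D(3) pair)+
    then show "weakly_converges_on UNIV (\<lambda>k. \<bb>n (r k) (x k)) (\<bb> l)"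
      by simp
  qed
  show ?thesis
    using i_iff_ii ii_iff_iii 1 2 3 4 5 by blast
qed

end
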